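(* For $n\ge 1$, let $\nu(n)$ denote the number of partitions of $n$ having no part equal to $1$, and let $\gamma(n)$ denote the number of partitions of $n$ having no part equal to $1$ and in which the largest part appears at least twice. Then, as $n\to\infty$, $$\nu(n)\ \sim\ \gamma(n)\sqrt{\frac{n}{\zeta(2)}},$$ where $\zeta(2)=\pi^2/6$.
   Context: Partitions with no part equal to $1$ are called non-unitary; those among them whose largest part occurs with multiplicity at least two are called ground state non-unitary partitions. $f(n)\sim g(n)$ means $f(n)/g(n)\to 1$. *)

theory Defs
  imports "HOL-Analysis.Analysis" "HOL-Library.Multiset" "HOL-Library.Landau_Symbols"
begin

definition partitions :: "nat \<Rightarrow> nat multiset set" where
  "partitions n = {M. (\<forall>p\<in>#M. p > 0) \<and> sum_mset M = n}"

definition nonunitary_partitions :: "nat \<Rightarrow> nat multiset set" where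
  "nonunitary_partitions n = {M \<in> partitions n. 1 \<notin># M}"

definition ground_state_nonunitary_partitions :: "nat \<Rightarrow> nat multiset set" where
  "ground_state_nonunitary_partitions n =
     {M \<in> nonunitary_partitions n. M \<noteq> {#} \<and> count M (Max_mset M) \<ge> 2}"

definition nu :: "nat \<Rightarrow> nat" where
  "nu n = card (nonunitary_partitions n)"

definition gamma_gs :: "nat \<Rightarrow> nat" where
  "gamma_gs n = card (ground_state_nonunitary_partitions n)"

end

theory Submission
  imports Defs "HOL-Probability.Probability" "HOL-Real_Asymp.Real_Asymp"
begin

text \<open>
  Lowering the unique largest part shows \<open>\<gamma>(n) = \<nu>(n) - \<nu>(n - 1)\<close> for \<open>n \<ge> 3\<close>. Hence \<open>\<nu>(n)\<close> and
  \<open>\<gamma>(n)\<close> are the coefficients of \<open>z^n\<close> in \<open>G(z)\<close> and \<open>(1 - z) G(z)\<close>, where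
  \<open>G(z) = (\<Prod>k=2..n. 1 / (1 - z^k))\<close>. Write both as integrals over the circle of radius \<open>e^-t\<close>, where
  \<open>t\<close> solves the saddle point equation \<open>(\<Sum>k=2..n. k / (e^(kt) - 1)) = n\<close>, and rescale the angle by the
  standard deviation, which has order \<open>t^(-3/2)\<close>. The normalised integrands converge
  to \<open>exp (-x\<^sup>2/2)\<close> and to \<open>t exp (-x\<^sup>2/2)\<close> respectively, because \<open>1 - z\<close> is asymptotic to \<open>t\<close> on the
  relevant scale, and they are dominated by a multiple of \<open>1 / (1 + x\<^sup>2)\<close>.
  So \<open>\<gamma>(n) / \<nu>(n)\<close> is asymptotic to \<open>t\<close>, and \<open>n t\<^sup>2\<close> tends to \<open>\<zeta>(2)\<close> by expanding the saddle point
  equation as \<open>n = (\<Sum>m\<ge>1. \<Sum>k=2..n. k e^(-mkt))\<close> and letting \<open>t\<close> tend to 0 termwise.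
\<close>

section \<open>Partitions without part 1\<close>

text \<open>Only a quotient of two coefficients is wanted, so the value of the product at the saddle
  point, the variance and the power of the radius cancel and need no asymptotic formula. An
  asymptotic for \<open>nu n\<close> alone would not do: \<open>nu n - nu (n - 1)\<close> is smaller
  than \<open>nu n\<close> by a factor of order n^(-1/2), below a relative error o(1). Keeping 1 - z
  inside the integral shows this factor before any limit is taken; it is t to first order because
  the relevant angles have order t^(3/2), far below t. Cutting the product at n leaves the
  coefficients up to n unchanged and keeps all sums over k finite. The cut must then be shown
  harmless for the estimates, which is where 1/t <= n and exp(-n t) <= t enter. A power as majorant
  is a choice forced by the range: the rescaled angle runs up to order t^(-3/2), while the bound
  obtained far from the saddle is only exp(-c/t), so no Gaussian majorant results from it.\<close>

definition bounded_partitions :: "nat \<Rightarrow> nat \<Rightarrow> nat multiset set" where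
  "bounded_partitions N m = {M. set_mset M \<subseteq> {2..N} \<and> sum_mset M = m}"

lemma member_le_sum_mset: "p \<in># M \<Longrightarrow> p \<le> sum_mset (M :: nat multiset)"
  by (metis le_add1 multi_member_split sum_mset.add_mset)

lemma size_le_sum_mset: "(\<forall>p\<in>#M. p > 0) \<Longrightarrow> size M \<le> sum_mset (M :: nat multiset)"
  by (induction M) auto

lemma finite_partitions: "finite (partitions n)"
proof (rule finite_subset)
  show "partitions n \<subseteq> {M. set_mset M \<subseteq> {..n} \<and> size M \<le> n}"
    unfolding partitions_def using member_le_sum_mset size_le_sum_mset by auto
  have "{M. set_mset M \<subseteq> {..n} \<and> size M \<le> n}
      = (\<Union>k\<le>n. {M. size M = k \<and> set_mset M \<subseteq> {..n}})"
    by auto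
  also have "finite \<dots>"
    using finite_multisets_of_size[of "{..n}"] by (auto simp: multisets_of_size_def conj_commute)
  finally show "finite {M. set_mset M \<subseteq> {..n} \<and> size M \<le> n}" .
qed

lemma nonunitary_partitions_alt:
  "nonunitary_partitions n = {M. (\<forall>p\<in>#M. 2 \<le> p) \<and> sum_mset M = n}"
proof -
  have "(\<forall>p\<in>#M. p > 0) \<and> 1 \<notin># M \<longleftrightarrow> (\<forall>p\<in>#M. p > 0 \<and> p \<noteq> 1)" for M :: "nat multiset"
    by auto
  moreover have "p > 0 \<and> p \<noteq> 1 \<longleftrightarrow> 2 \<le> p" for p :: nat
    by auto
  ultimately have "(\<forall>p\<in>#M. p > 0) \<and> 1 \<notin># M \<longleftrightarrow> (\<forall>p\<in>#M. 2 \<le> p)" for M :: "nat multiset"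
    by simp
  thus ?thesis
    unfolding nonunitary_partitions_def partitions_def by blast
qed

lemma finite_nonunitary_partitions: "finite (nonunitary_partitions n)"
  using finite_partitions unfolding nonunitary_partitions_def by auto

lemma bounded_partitions_subset: "bounded_partitions N m \<subseteq> nonunitary_partitions m"
  unfolding nonunitary_partitions_alt bounded_partitions_def by auto

lemma finite_bounded_partitions: "finite (bounded_partitions N m)"
  using bounded_partitions_subset finite_nonunitary_partitions by (rule finite_subset)

lemma bounded_partitions_eq:
  assumes "m \<le> N"
  shows "bounded_partitions N m = nonunitary_partitions m"
  unfolding nonunitary_partitions_alt bounded_partitions_def
  using assms member_le_sum_mset by fastforce

lemma card_bounded_partitions_1: "card (bounded_partitions (Suc 0) m) = of_bool (m = 0)"
proof -
  have "bounded_partitions (Suc 0) m = (if m = 0 then {{#}} else {})"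
    unfolding bounded_partitions_def by auto
  thus ?thesis by simp
qed

text \<open>Coefficient form of B(z) = A(z) + z^(N+1) B(z): a partition either avoids the part N+1
  or loses one copy of it. This one recurrence drives both the convergence proof and the product
  formula.\<close>

lemma card_bounded_partitions_Suc:
  assumes "N \<ge> 1"
  shows "card (bounded_partitions (Suc N) m) = card (bounded_partitions N m)
     + (if Suc N \<le> m then card (bounded_partitions (Suc N) (m - Suc N)) else 0)"
proof -
  let ?A = "{M \<in> bounded_partitions (Suc N) m. Suc N \<in># M}"
  have split: "bounded_partitions (Suc N) m = bounded_partitions N m \<union> ?A"
    unfolding bounded_partitions_def using le_Suc_eq by (fastforce simp: subset_iff)
  have "bounded_partitions N m \<inter> ?A = {}"
    unfolding bounded_partitions_def by auto
  hence "card (bounded_partitions (Suc N) m) = card (bounded_partitions N m) + card ?A"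
    using split finite_bounded_partitions
    by (metis (no_types, lifting) card_Un_disjoint finite_Un)
  also have "card ?A = (if Suc N \<le> m then card (bounded_partitions (Suc N) (m - Suc N)) else 0)"
  proof (cases "Suc N \<le> m")
    case True
    have "bij_betw (add_mset (Suc N)) (bounded_partitions (Suc N) (m - Suc N)) ?A"
    proof (rule bij_betwI[where g = "\<lambda>M. M - {#Suc N#}"])
      show "add_mset (Suc N) \<in> bounded_partitions (Suc N) (m - Suc N) \<rightarrow> ?A"
        using assms True unfolding bounded_partitions_def by auto
      show "(\<lambda>M. M - {#Suc N#}) \<in> ?A \<rightarrow> bounded_partitions (Suc N) (m - Suc N)"
        unfolding bounded_partitions_def
        by (auto simp: sum_mset_diff dest: in_diffD)
    qed auto
    thus ?thesis using True by (simp add: bij_betw_same_card)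
  next
    case False
    hence "?A = {}"
      unfolding bounded_partitions_def using member_le_sum_mset by auto
    thus ?thesis using False by (simp only: card.empty if_False)
  qed
  finally show ?thesis .
qed

section \<open>Lowering a largest part that occurs once\<close>

lemma Max_mset_add_mset:
  fixes m :: nat
  assumes "\<forall>p\<in>#K. p \<le> m"
  shows "Max_mset (add_mset m K) = m"
  using assms by (intro Max_eqI) auto

text \<open>A partition without 1 whose largest part occurs once arises by increasing the largest part
  of a partition without 1 of the predecessor; only \<open>2 = 2\<close> is an exception.\<close>

lemma gamma_gs_eq:
  assumes "n \<ge> 3"
  shows "nu n = gamma_gs n + nu (n - 1)"
proof -
  let ?G = "ground_state_nonunitary_partitions n"
  let ?B = "nonunitary_partitions n - ?G"
  let ?f = "\<lambda>M. add_mset (Max_mset M + 1) (M - {#Max_mset M#})"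
  let ?g = "\<lambda>M. add_mset (Max_mset M - 1) (M - {#Max_mset M#})"
  have n1: "n - 1 > 0" using assms by simp
  have G: "?G \<subseteq> nonunitary_partitions n"
    unfolding ground_state_nonunitary_partitions_def by auto
  have decomp: "\<exists>m K. M = add_mset m K \<and> Max_mset M = m \<and> (\<forall>p\<in>#K. p \<le> m) \<and> 2 \<le> m \<and> (\<forall>p\<in>#K. 2 \<le> p) \<and> m + sum_mset K = k"
    if "M \<in> nonunitary_partitions k" "k > 0" for M k
  proof -
    have "M \<noteq> {#}" using that unfolding nonunitary_partitions_alt by auto
    then obtain m where m: "m = Max_mset M" "m \<in># M" by simp
    then obtain K where K: "M = add_mset m K" by (metis multi_member_split)
    have "\<forall>p\<in>#M. p \<le> m" by (simp add: m)
    moreover have "(\<forall>p\<in>#M. 2 \<le> p) \<and> sum_mset M = k"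
      using that unfolding nonunitary_partitions_alt by simp
    ultimately have "(\<forall>p\<in>#K. p \<le> m) \<and> 2 \<le> m \<and> (\<forall>p\<in>#K. 2 \<le> p) \<and> m + sum_mset K = k"
      unfolding K by simp
    thus ?thesis using K m(1)[symmetric] by (intro exI[of _ m] exI[of _ K]) (rule conjI, assumption, rule conjI, assumption, assumption)
  qed
  have B: "\<exists>m K. M = add_mset m K \<and> Max_mset M = m \<and> (\<forall>p\<in>#K. p < m) \<and> 3 \<le> m \<and> (\<forall>p\<in>#K. 2 \<le> p) \<and> m + sum_mset K = n"
    if "M \<in> ?B" for M
  proof -
    have Mn: "M \<in> nonunitary_partitions n" and n0: "n > 0" using that assms by auto
    obtain m K where *: "M = add_mset m K" "Max_mset M = m" "\<forall>p\<in>#K. p \<le> m" "2 \<le> m"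
        "\<forall>p\<in>#K. 2 \<le> p" "m + sum_mset K = n"
      using decomp[OF Mn n0] by blast
    have "\<not> count M (Max_mset M) \<ge> 2"
      using that * unfolding ground_state_nonunitary_partitions_def by auto
    hence "m \<notin># K" using * by (simp add: not_in_iff)
    hence lt: "\<forall>p\<in>#K. p < m" using * by (metis nat_less_le)
    \<comment> \<open>With m = 2 the strict bound leaves no room for another part, so n = 2,
      contrary to n >= 3. For m >= 3 lowering cannot create a part 1.\<close>
    have "m \<noteq> 2"
    proof
      assume "m = 2"
      hence "K = {#}" using lt * by (metis linorder_not_less multiset_nonemptyE)
      thus False using * assms \<open>m = 2\<close> by simp
    qed
    thus ?thesis using * lt by (intro exI[of _ m] exI[of _ K]) auto
  qed
  have "bij_betw ?g ?B (nonunitary_partitions (n - 1))"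
  proof (rule bij_betwI[where g = ?f])
    show "?g \<in> ?B \<rightarrow> nonunitary_partitions (n - 1)"
    proof
      fix M assume "M \<in> ?B"
      then obtain m K where "M = add_mset m K" "Max_mset M = m" "\<forall>p\<in>#K. p < m" "3 \<le> m"
        "\<forall>p\<in>#K. 2 \<le> p" "m + sum_mset K = n" using B by blast
      thus "?g M \<in> nonunitary_partitions (n - 1)" unfolding nonunitary_partitions_alt by auto
    qed
    show "?f \<in> nonunitary_partitions (n - 1) \<rightarrow> ?B"
    proof
      fix M assume "M \<in> nonunitary_partitions (n - 1)"
      then obtain m K where *: "M = add_mset m K" "Max_mset M = m" "\<forall>p\<in>#K. p \<le> m" "2 \<le> m"
        "\<forall>p\<in>#K. 2 \<le> p" "m + sum_mset K = n - 1" using decomp[of M "n - 1", OF _ n1] by blast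
      have f: "?f M = add_mset (m + 1) K" using * by simp
      have "Max_mset (add_mset (m + 1) K) = m + 1"
        using * by (intro Max_mset_add_mset) auto
      moreover have "m + 1 \<notin># K" using * by auto
      ultimately show "?f M \<in> ?B"
        unfolding f using * assms
        by (auto simp: ground_state_nonunitary_partitions_def nonunitary_partitions_alt not_in_iff)
    qed
    fix M assume "M \<in> ?B"
    then obtain m K where *: "M = add_mset m K" "Max_mset M = m" "\<forall>p\<in>#K. p < m" "3 \<le> m"
        "\<forall>p\<in>#K. 2 \<le> p" "m + sum_mset K = n" using B by blast
    have "?g M = add_mset (m - 1) K" using * by simp
    moreover have "Max_mset (add_mset (m - 1) K) = m - 1"
      using * by (intro Max_mset_add_mset) auto
    ultimately show "?f (?g M) = M" using * by simp
  next
    fix M assume "M \<in> nonunitary_partitions (n - 1)"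
    then obtain m K where *: "M = add_mset m K" "Max_mset M = m" "\<forall>p\<in>#K. p \<le> m" "2 \<le> m"
        "\<forall>p\<in>#K. 2 \<le> p" "m + sum_mset K = n - 1" using decomp[of M "n - 1", OF _ n1] by blast
    have "?f M = add_mset (m + 1) K" using * by simp
    moreover have "Max_mset (add_mset (m + 1) K) = m + 1"
      using * by (intro Max_mset_add_mset) auto
    ultimately show "?g (?f M) = M" using * by simp
  qed
  hence "card ?B = nu (n - 1)" unfolding nu_def by (rule bij_betw_same_card)
  thus ?thesis
    using card_Diff_subset[OF _ G] card_mono[OF finite_nonunitary_partitions G]
      finite_subset[OF G finite_nonunitary_partitions]
    unfolding nu_def gamma_gs_def by simp
qed

section \<open>Generating functions and coefficient integrals\<close>

definition partition_prod :: "nat \<Rightarrow> complex \<Rightarrow> complex" where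
  "partition_prod N z = (\<Prod>k=2..N. 1 / (1 - z ^ k))"

lemma norm_power_less_1: "norm (z::complex) < 1 \<Longrightarrow> k > 0 \<Longrightarrow> norm (z ^ k) < 1"
  by (simp add: norm_power power_less_one_iff)

text \<open>Convergence has to be known before the recurrence can be solved for the sum of the
  series; it is proved for real arguments, where the partial sums are monotone.\<close>

lemma summable_bounded_partitions:
  fixes x :: real
  assumes x: "0 \<le> x" "x < 1" and N: "N \<ge> 1"
  shows "summable (\<lambda>m. real (card (bounded_partitions N m)) * x ^ m)"
  using N
proof (induction N rule: dec_induct)
  case base
  show ?case by (rule summable_finite[of "{0}"]) (auto simp: card_bounded_partitions_1)
next
  case (step N)
  define a where "a = (\<lambda>m. real (card (bounded_partitions N m)) * x ^ m)"
  define b where "b = (\<lambda>m. real (card (bounded_partitions (Suc N) m)) * x ^ m)"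
  have xN: "x ^ Suc N < 1" using power_Suc_less_one[of x N] x by (cases "x = 0") (auto simp del: power_Suc)
  have a0: "a m \<ge> 0" and b0: "b m \<ge> 0" for m using x by (auto simp: a_def b_def)
  have rec: "b m = a m + (if Suc N \<le> m then x ^ Suc N * b (m - Suc N) else 0)" for m
    using card_bounded_partitions_Suc[OF step.hyps(1), of m]
    by (cases "Suc N \<le> m") (auto simp: a_def b_def algebra_simps power_add dest!: le_Suc_ex)
  have "(\<Sum>m<M. b m) \<le> suminf a / (1 - x ^ Suc N)" for M
  proof -
    have "(\<Sum>m<M. b m) = (\<Sum>m<M. a m) + (\<Sum>m<M. if Suc N \<le> m then x ^ Suc N * b (m - Suc N) else 0)"
      by (subst rec) (simp add: sum.distrib)
    also have "(\<Sum>m<M. if Suc N \<le> m then x ^ Suc N * b (m - Suc N) else 0)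
        = (\<Sum>m\<in>{Suc N..<M}. x ^ Suc N * b (m - Suc N))"
      by (rule sum.mono_neutral_cong_right) auto
    also have "\<dots> = (\<Sum>m<M - Suc N. x ^ Suc N * b m)"
      by (rule sum.reindex_bij_witness[of _ "\<lambda>m. m + Suc N" "\<lambda>m. m - Suc N"]) auto
    \<comment> \<open>Completing the shorter shifted sum by nonnegative terms gives S <= A + x^(N+1)
      S for the partial sum S, which bounds S because x^(N+1) < 1.\<close>
    also have "\<dots> \<le> (\<Sum>m<M. x ^ Suc N * b m)"
      using b0 x by (intro sum_mono2) auto
    also have "\<dots> = x ^ Suc N * (\<Sum>m<M. b m)" by (rule sum_distrib_left[symmetric])
    also have "(\<Sum>m<M. a m) \<le> suminf a"
      using step.IH a0 unfolding a_def[symmetric] by (intro sum_le_suminf) auto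
    finally have "(\<Sum>m<M. b m) \<le> suminf a + x ^ Suc N * (\<Sum>m<M. b m)" by simp
    thus ?thesis using xN by (simp add: field_simps)
  qed
  hence "summable b" using b0 by (intro summableI_nonneg_bounded[of b]) auto
  thus ?case by (simp add: b_def)
qed

text \<open>Given convergence, the recurrence is a linear equation for the sum, and solving it adds
  the factor 1 / (1 - z^(N+1)).\<close>

lemma bounded_partitions_sums:
  fixes z :: complex
  assumes z: "norm z < 1" and N: "N \<ge> 1"
  shows "(\<lambda>m. of_nat (card (bounded_partitions N m)) * z ^ m) sums partition_prod N z"
  using N
proof (induction N rule: dec_induct)
  case base
  have "(\<lambda>m. of_nat (card (bounded_partitions (Suc 0) m)) * z ^ m) = (\<lambda>m. if m = 0 then 1 else 0)"
    by (auto simp: card_bounded_partitions_1)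
  thus ?case using sums_single[of 0 "\<lambda>_. 1::complex"] by (simp add: partition_prod_def)
next
  case (step N)
  define a where "a = (\<lambda>m. of_nat (card (bounded_partitions N m)) * z ^ m)"
  define b where "b = (\<lambda>m. of_nat (card (bounded_partitions (Suc N) m)) * z ^ m)"
  have zN: "z ^ Suc N \<noteq> 1" using norm_power_less_1[OF z, of "Suc N"] by auto
  have rec: "b m = a m + (if Suc N \<le> m then z ^ Suc N * b (m - Suc N) else 0)" for m
    using card_bounded_partitions_Suc[OF step.hyps(1), of m]
    by (cases "Suc N \<le> m") (auto simp: a_def b_def algebra_simps power_add dest!: le_Suc_ex)
  have "summable b"
  proof (rule summable_norm_cancel)
    show "summable (\<lambda>m. norm (b m))"
      using summable_bounded_partitions[of "norm z" "Suc N"] z by (simp add: b_def norm_mult norm_power)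
  qed
  then obtain B where B: "b sums B" by blast
  have "(\<lambda>m. if Suc N \<le> m then z ^ Suc N * b (m - Suc N) else 0) sums (z ^ Suc N * B)"
  proof -
    have "(\<lambda>m. if Suc N \<le> m + Suc N then z ^ Suc N * b (m + Suc N - Suc N) else 0) sums (z ^ Suc N * B)"
      using sums_mult[OF B] by simp
    thus ?thesis
      by (subst (asm) sums_zero_iff_shift[where f = "\<lambda>m. if Suc N \<le> m then z ^ Suc N * b (m - Suc N) else 0"]) auto
  qed
  from sums_add[OF step.IH[folded a_def] this] have "b sums (partition_prod N z + z ^ Suc N * B)"
    unfolding rec[symmetric] .
  hence "B = partition_prod N z + z ^ Suc N * B" using B sums_unique2 by blast
  hence "B = partition_prod N z / (1 - z ^ Suc N)" using zN by (simp add: field_simps)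
  also have "\<dots> = partition_prod (Suc N) z"
    using step by (simp add: partition_prod_def)
  finally show ?case using B by (simp add: b_def)
qed

section \<open>Coefficients as integrals over a circle\<close>

lemma integral_cis:
  fixes j :: int
  shows "((\<lambda>\<theta>. cis (of_int j * \<theta>)) has_integral (if j = 0 then of_real (2 * pi) else 0)) {-pi..pi}"
proof (cases "j = 0")
  case True
  thus ?thesis using has_integral_const_real[of "1::complex" "-pi" pi] by (simp add: scaleR_conv_of_real)
next
  case False
  have "((\<lambda>\<theta>. cis (of_int j * \<theta>)) has_integral
      (cis (of_int j * pi) / (\<i> * of_int j) - cis (of_int j * (- pi)) / (\<i> * of_int j))) {-pi..pi}"
  proof (rule fundamental_theorem_of_calculus)
    fix x assume "x \<in> {-pi..pi}"
    have "((\<lambda>\<theta>. exp (\<i> * (of_int j * of_real \<theta>)) / (\<i> * of_int j)) has_vector_derivative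
        exp (\<i> * (of_int j * of_real x))) (at x within {-pi..pi})"
      using False by (auto intro!: derivative_eq_intros has_vector_derivative_real_field simp: field_simps)
    thus "((\<lambda>\<theta>. cis (of_int j * \<theta>) / (\<i> * of_int j)) has_vector_derivative
        cis (of_int j * x)) (at x within {-pi..pi})"
      by (simp add: cis_conv_exp)
  qed simp
  moreover have "cis (of_int j * pi) = cis (of_int j * (- pi))"
    by (simp add: complex_eq_iff mult.commute)
  ultimately show ?thesis using False by simp
qed

text \<open>Cauchy's coefficient formula by orthogonality: absolute convergence on the circle gives
  uniform convergence by the M-test, so the series is integrated termwise and only m = n
  survives.\<close>

lemma coefficient_integral:
  fixes c :: "nat \<Rightarrow> complex"
  assumes q: "0 \<le> q" and summ: "summable (\<lambda>m. norm (c m) * q ^ m)"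
    and F: "\<And>\<theta>. (\<lambda>m. c m * (of_real q * cis \<theta>) ^ m) sums F \<theta>"
  shows "((\<lambda>\<theta>. F \<theta> * cis (- (real n * \<theta>))) has_integral (of_real (2 * pi) * c n * of_real (q ^ n))) {-pi..pi}"
proof -
  define f where "f = (\<lambda>m \<theta>. c m * (of_real q * cis \<theta>) ^ m * cis (- (real n * \<theta>)))"
  have f_alt: "f m \<theta> = c m * of_real (q ^ m) * cis (of_int (int m - int n) * \<theta>)" for m \<theta>
    by (simp add: f_def power_mult_distrib Complex.DeMoivre cis_mult algebra_simps)
  have fint: "(f m has_integral (if m = n then of_real (2 * pi) * c n * of_real (q ^ n) else 0)) {-pi..pi}" for m
    using has_integral_mult_right[OF integral_cis[of "int m - int n"], of "c m * of_real (q ^ m)"]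
    unfolding f_alt by (auto simp: algebra_simps split: if_splits)
  have unif: "uniform_limit {-pi..pi} (\<lambda>M \<theta>. \<Sum>m<M. f m \<theta>) (\<lambda>\<theta>. F \<theta> * cis (- (real n * \<theta>))) sequentially"
  proof -
    have "uniform_limit {-pi..pi} (\<lambda>M \<theta>. \<Sum>m<M. f m \<theta>) (\<lambda>\<theta>. \<Sum>m. f m \<theta>) sequentially"
      using q by (intro Weierstrass_m_test[OF _ summ]) (auto simp: f_alt norm_mult norm_power)
    moreover have "(\<Sum>m. f m \<theta>) = F \<theta> * cis (- (real n * \<theta>))" for \<theta>
      using sums_mult2[OF F[of \<theta>], of "cis (- (real n * \<theta>))"] by (simp add: f_def sums_iff)
    ultimately show ?thesis by simp
  qed
  have psum: "((\<lambda>\<theta>. \<Sum>m<M. f m \<theta>) has_integral (\<Sum>m<M. if m = n then of_real (2 * pi) * c n * of_real (q ^ n) else 0)) {-pi..pi}" for M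
    using fint by (intro has_integral_sum) auto
  obtain I J where I: "\<And>M. ((\<lambda>\<theta>. \<Sum>m<M. f m \<theta>) has_integral I M) {-pi..pi}"
    and J: "((\<lambda>\<theta>. F \<theta> * cis (- (real n * \<theta>))) has_integral J) {-pi..pi}" and lim: "I \<longlonglongrightarrow> J"
  proof (rule uniform_limit_integral[OF unif])
    show "continuous_on {-pi..pi} (\<lambda>\<theta>. \<Sum>m<M. f m \<theta>)" for M
      unfolding f_def by (intro continuous_intros)
  qed auto
  have "I M = of_real (2 * pi) * c n * of_real (q ^ n)" if "M > n" for M
    using has_integral_unique[OF I psum] that by simp
  hence "eventually (\<lambda>M. I M = of_real (2 * pi) * c n * of_real (q ^ n)) sequentially"
    by (rule eventually_mono[OF eventually_gt_at_top[of n]])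
  hence "I \<longlonglongrightarrow> of_real (2 * pi) * c n * of_real (q ^ n)" by (rule tendsto_eventually)
  thus ?thesis using J lim LIMSEQ_unique by blast
qed

lemma nu_integral:
  assumes q: "0 \<le> q" "q < 1" and n: "n \<ge> 1"
  shows "((\<lambda>\<theta>. partition_prod n (of_real q * cis \<theta>) * cis (- (real n * \<theta>))) has_integral
           of_real (2 * pi * real (nu n) * q ^ n)) {-pi..pi}"
proof -
  let ?c = "\<lambda>m. of_nat (card (bounded_partitions n m)) :: complex"
  have "((\<lambda>\<theta>. partition_prod n (of_real q * cis \<theta>) * cis (- (real n * \<theta>))) has_integral
           of_real (2 * pi) * ?c n * of_real (q ^ n)) {-pi..pi}"
  proof (rule coefficient_integral[OF q(1), where c = ?c])
    show "summable (\<lambda>m. norm (?c m) * q ^ m)" using summable_bounded_partitions[OF q n] by simp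
    show "(\<lambda>m. ?c m * (of_real q * cis \<theta>) ^ m) sums partition_prod n (of_real q * cis \<theta>)" for \<theta>
      using q n by (intro bounded_partitions_sums) (auto simp: norm_mult)
  qed
  moreover have "card (bounded_partitions n n) = nu n" by (simp add: bounded_partitions_eq nu_def)
  ultimately show ?thesis by simp
qed

lemma gamma_integral:
  assumes q: "0 \<le> q" "q < 1" and n: "n \<ge> 3"
  shows "((\<lambda>\<theta>. (1 - of_real q * cis \<theta>) * partition_prod n (of_real q * cis \<theta>) * cis (- (real n * \<theta>)))
           has_integral of_real (2 * pi * real (gamma_gs n) * q ^ n)) {-pi..pi}"
proof -
  let ?c = "\<lambda>m. of_nat (card (bounded_partitions n m)) :: complex"
  \<comment> \<open>Coefficients of z times the series: a shift by one, with 0 at index 0, where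
    truncated subtraction would repeat \<open>?c 0\<close>.\<close>
  let ?d = "\<lambda>m. if m = 0 then 0 else ?c (m - 1)"
  have n1: "n \<ge> 1" using n by simp
  have "((\<lambda>\<theta>. (1 - of_real q * cis \<theta>) * partition_prod n (of_real q * cis \<theta>) * cis (- (real n * \<theta>))) has_integral
           of_real (2 * pi) * (?c n - ?d n) * of_real (q ^ n)) {-pi..pi}"
  proof (rule coefficient_integral[OF q(1), where c = "\<lambda>m. ?c m - ?d m"])
    have s1: "summable (\<lambda>m. norm (?c m) * q ^ m)" using summable_bounded_partitions[OF q n1] by simp
    have "summable (\<lambda>m. norm (?d (Suc m)) * q ^ Suc m)"
      using summable_mult[OF s1, of q] by (simp add: mult_ac)
    hence s2: "summable (\<lambda>m. norm (?d m) * q ^ m)" by (subst (asm) summable_Suc_iff)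
    show "summable (\<lambda>m. norm (?c m - ?d m) * q ^ m)"
    proof (rule summable_comparison_test'[OF summable_add[OF s1 s2], of 0])
      fix m :: nat
      have "norm (?c m - ?d m) * q ^ m \<le> (norm (?c m) + norm (?d m)) * q ^ m"
        using q by (intro mult_right_mono norm_triangle_ineq4) auto
      thus "norm (norm (?c m - ?d m) * q ^ m) \<le> norm (?c m) * q ^ m + norm (?d m) * q ^ m"
        using q by (simp only: real_norm_def abs_mult abs_norm_cancel power_abs abs_of_nonneg distrib_right)
    qed
    show "(\<lambda>m. (?c m - ?d m) * (of_real q * cis \<theta>) ^ m) sums
       ((1 - of_real q * cis \<theta>) * partition_prod n (of_real q * cis \<theta>))" for \<theta>
    proof -
      define z where "z = of_real q * cis \<theta>"
      have c: "(\<lambda>m. ?c m * z ^ m) sums partition_prod n z"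
        using q n1 by (intro bounded_partitions_sums) (auto simp: norm_mult z_def)
      have "(\<lambda>m. ?d (Suc m) * z ^ Suc m) sums (z * partition_prod n z)"
        using sums_mult[OF c, of z] by (simp add: mult_ac)
      hence d: "(\<lambda>m. ?d m * z ^ m) sums (z * partition_prod n z)" by (subst (asm) sums_Suc_iff) simp
      from sums_diff[OF c d] show ?thesis by (simp add: z_def algebra_simps)
    qed
  qed
  moreover have "?c n - ?d n = of_nat (gamma_gs n)"
  proof -
    have "card (bounded_partitions n n) = nu n" "card (bounded_partitions n (n - 1)) = nu (n - 1)"
      by (simp_all add: bounded_partitions_eq nu_def)
    thus ?thesis using n by (simp add: gamma_gs_eq[OF n])
  qed
  ultimately show ?thesis by simp
qed

section \<open>The saddle point\<close>

lemma one_minus_exp_ge: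
  fixes y :: real
  assumes "y > 0"
  shows "y / (1 + y) \<le> 1 - exp (- y)"
proof -
  have "1 + y \<le> exp y" by simp
  hence "exp (- y) \<le> 1 / (1 + y)" using assms by (simp add: exp_minus field_simps)
  also have "1 / (1 + y) = 1 - y / (1 + y)" using assms by (simp add: field_simps)
  finally show ?thesis by linarith
qed

text \<open>The left side is 1 / (2 sinh (y/2))^2, so the bound amounts to sinh u >= u. With y =
  (m+1) t it yields a majorant summable in m.\<close>

lemma exp_quotient_le_inverse_square:
  fixes y :: real
  assumes "y > 0"
  shows "exp (- y) / (1 - exp (- y))\<^sup>2 \<le> 1 / y\<^sup>2"
proof -
  define u where "u = y / 2"
  have u: "u > 0" using assms by (simp add: u_def)
  have "u \<le> sinh u"
  proof -
    have "((\<lambda>x. sinh x - x) has_real_derivative (cosh x - 1)) (at x)" for x :: real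
      by (auto intro!: derivative_eq_intros)
    moreover have "cosh x - 1 \<ge> 0" for x :: real using cosh_real_ge_1[of x] by simp
    ultimately have "sinh 0 - 0 \<le> sinh u - u"
      using u by (intro DERIV_nonneg_imp_nondecreasing[of 0 u "\<lambda>x. sinh x - x"] less_imp_le[OF u])
        blast
    thus ?thesis by simp
  qed
  hence s: "y \<le> 2 * sinh u" by (simp add: u_def)
  have e: "1 - exp (- y) = exp (- u) * (2 * sinh u)"
    by (simp add: sinh_field_def field_simps u_def flip: exp_add)
  have e2: "exp (- y) = (exp (- u))\<^sup>2" by (simp add: u_def flip: exp_double)
  have "sinh u > 0" using u by simp
  hence "exp (- y) / (1 - exp (- y))\<^sup>2 = 1 / (2 * sinh u)\<^sup>2"
    unfolding e unfolding e2 by (simp add: power_mult_distrib)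
  also have "\<dots> \<le> 1 / y\<^sup>2"
    using s assms \<open>sinh u > 0\<close> by (intro divide_left_mono power_mono mult_pos_pos) auto
  finally show ?thesis .
qed

lemma sum_of_nat_power_eq:
  fixes x :: real
  assumes "x \<noteq> 1"
  shows "(\<Sum>k=1..N. real k * x ^ k) = x * (1 - (real N + 1) * x ^ N + real N * x ^ Suc N) / (1 - x)\<^sup>2"
proof (induction N)
  case (Suc N)
  have "(\<Sum>k=1..Suc N. real k * x ^ k) = x * (1 - (real N + 1) * x ^ N + real N * x ^ Suc N) / (1 - x)\<^sup>2
       + real (Suc N) * x ^ Suc N"
    using Suc by simp
  also have "\<dots> = x * (1 - (real (Suc N) + 1) * x ^ Suc N + real (Suc N) * x ^ Suc (Suc N)) / (1 - x)\<^sup>2"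
  proof -
    have nz: "(1 - x)\<^sup>2 \<noteq> 0" using assms by simp
    have num: "x * (1 - (real N + 1) * x ^ N + real N * x ^ Suc N) + real (Suc N) * x ^ Suc N * (1 - x)\<^sup>2
       = x * (1 - (real (Suc N) + 1) * x ^ Suc N + real (Suc N) * x ^ Suc (Suc N))"
      by (simp add: algebra_simps power2_eq_square)
    show ?thesis by (simp only: divide_add_eq_iff[OF nz] num)
  qed
  finally show ?case .
qed simp

text \<open>The sum is minus the derivative in t of the logarithm of the product at e^(-t). The
  equation thus makes n t plus this logarithm stationary, and the term linear in \<theta> will
  cancel.\<close>

definition saddle_equation :: "nat \<Rightarrow> real \<Rightarrow> bool" where
  "saddle_equation n t \<longleftrightarrow> 0 < t \<and> (\<Sum>k=2..n. real k / (exp (real k * t) - 1)) = real n"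

lemma saddle_exists:
  assumes n: "n \<ge> 2"
  shows "\<exists>t. saddle_equation n t"
proof -
  define f where "f = (\<lambda>t. \<Sum>k=2..n. real k / (exp (real k * t) - 1))"
  \<comment> \<open>Chosen so that the summand k = 2 alone equals n at \<open>a\<close>. At 1 every
    summand is at most 1, so the value n is attained in between.\<close>
  define a where "a = ln (1 + 2 / real n) / 2"
  have a: "0 < a" using n unfolding a_def by (intro divide_pos_pos ln_gt_zero) auto
  have "ln (1 + 2 / real n) \<le> 2 / real n" using n by (intro ln_add_one_self_le_self) simp
  also have "\<dots> \<le> 2" using n by (simp add: field_simps)
  finally have a1: "a \<le> 1" unfolding a_def by simp
  have "f 1 \<le> (\<Sum>k=2..n. 1)"
    unfolding f_def
  proof (rule sum_mono)
    fix k assume "k \<in> {2..n}"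
    moreover have "1 + real k \<le> exp (real k)" by simp
    ultimately show "real k / (exp (real k * 1) - 1) \<le> 1" by (simp add: field_simps)
  qed
  hence f1: "f 1 \<le> real n" by simp
  have "2 * a = ln (1 + 2 / real n)" by (simp add: a_def)
  hence "exp (2 * a) = 1 + 2 / real n" using n by (simp add: add_pos_nonneg)
  hence "real n = real 2 / (exp (real 2 * a) - 1)" using n by simp
  also have "\<dots> \<le> f a"
    unfolding f_def using a n by (intro member_le_sum[where f = "\<lambda>k. real k / (exp (real k * a) - 1)"]) auto
  finally have fa: "real n \<le> f a" .
  have "continuous_on {a..1} f"
    unfolding f_def using a by (intro continuous_intros) auto
  from IVT2'[of f 1 "real n" a, OF f1 fa a1 this] obtain t where "a \<le> t" "f t = real n" by auto
  thus ?thesis using a unfolding saddle_equation_def f_def by (intro exI[of _ t]) auto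
qed

text \<open>Each k / (e^(kt) - 1) is a geometric series. Summing over k first leaves, for fixed m
  and small t, a sum close to 1 / ((m+1) t)^2, which is how zeta(2) arises.\<close>

lemma saddle_sums:
  assumes "saddle_equation n t"
  shows "(\<lambda>m. \<Sum>k=2..n. real k * exp (- (real (Suc m) * t)) ^ k) sums real n"
proof -
  have t: "t > 0" using assms by (simp add: saddle_equation_def)
  have "(\<lambda>m. real k * exp (- (real (Suc m) * t)) ^ k) sums (real k / (exp (real k * t) - 1))"
    if "k \<in> {2..n}" for k
  proof -
    have k: "k > 0" using that by auto
    define x where "x = exp (- (real k * t))"
    have x: "0 < x" "x < 1" using k t by (auto simp: x_def)
    have "(\<lambda>m. real k * x * x ^ m) sums (real k * x * (1 / (1 - x)))"
      using x by (intro sums_mult geometric_sums) auto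
    moreover have "real k * x * x ^ m = real k * exp (- (real (Suc m) * t)) ^ k" for m
      by (simp add: x_def algebra_simps flip: exp_of_nat_mult exp_add)
    moreover have "real k * x * (1 / (1 - x)) = real k / (exp (real k * t) - 1)"
      using x k t by (simp add: x_def exp_minus field_simps)
    ultimately show ?thesis by simp
  qed
  hence "(\<lambda>m. \<Sum>k=2..n. real k * exp (- (real (Suc m) * t)) ^ k) sums
      (\<Sum>k=2..n. real k / (exp (real k * t) - 1))"
    by (rule sums_sum)
  thus ?thesis using assms by (simp add: saddle_equation_def)
qed

text \<open>Extending the range to all k >= 1 gives the larger value x / (1 - x)^2, to which the
  sinh estimate applies. The bound is uniform in n, as Tannery's theorem requires.\<close>

lemma saddle_term_bound:
  assumes t: "t > 0"
  shows "(\<Sum>k=2..n. real k * exp (- (real (Suc m) * t)) ^ k) \<le> 1 / (real (Suc m) * t)\<^sup>2"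
proof -
  define x where "x = exp (- (real (Suc m) * t))"
  have x: "0 < x" "x < 1" using t by (auto simp: x_def)
  have "(\<Sum>k=2..n. real k * x ^ k) \<le> (\<Sum>k=1..n. real k * x ^ k)"
    using x by (intro sum_mono2) auto
  also have "\<dots> = x * (1 - (real n + 1) * x ^ n + real n * x ^ Suc n) / (1 - x)\<^sup>2"
    using x by (intro sum_of_nat_power_eq) auto
  also have "\<dots> \<le> x * 1 / (1 - x)\<^sup>2"
  proof (intro divide_right_mono mult_left_mono)
    have "real n * x ^ Suc n \<le> (real n + 1) * x ^ n"
      using x by (intro mult_mono) (auto simp: mult_le_cancel_right1)
    thus "1 - (real n + 1) * x ^ n + real n * x ^ Suc n \<le> 1" by simp
  qed (use x in auto)
  also have "\<dots> \<le> 1 / (real (Suc m) * t)\<^sup>2"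
    using exp_quotient_le_inverse_square[of "real (Suc m) * t"] t by (simp add: x_def)
  finally show ?thesis unfolding x_def .
qed

lemma saddle_upper:
  assumes "saddle_equation n t"
  shows "real n * t\<^sup>2 \<le> pi\<^sup>2 / 6"
proof -
  have t: "t > 0" using assms by (simp add: saddle_equation_def)
  have "real n \<le> pi\<^sup>2 / 6 / t\<^sup>2"
  proof (rule sums_le[OF _ saddle_sums[OF assms]])
    show "(\<lambda>m. 1 / (real m + 1)\<^sup>2 / t\<^sup>2) sums (pi\<^sup>2 / 6 / t\<^sup>2)"
      by (intro sums_divide) (use inverse_squares_sums in \<open>simp add: add_ac\<close>)
    show "(\<Sum>k=2..n. real k * exp (- (real (Suc m) * t)) ^ k) \<le> 1 / (real m + 1)\<^sup>2 / t\<^sup>2" for m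
      using saddle_term_bound[OF t, of m n] by (simp add: power_mult_distrib add_ac)
  qed
  thus ?thesis using t by (simp add: field_simps)
qed

text \<open>A crude bound from the indices with k t <= 1, each contributing at least 1/(2t). It
  precedes the sharp limit because that limit needs n t to tend to infinity; the second claim says
  that the cut at n lies beyond the scale 1/t.\<close>

lemma saddle_lower:
  assumes "saddle_equation n t" "t \<le> 1/4" "n \<ge> 4"
  shows "1/4 \<le> real n * t\<^sup>2" "1 / t \<le> real n"
proof -
  have t: "t > 0" using assms by (simp add: saddle_equation_def)
  define K where "K = nat \<lfloor>1 / t\<rfloor>"
  have K: "real K \<le> 1 / t" "1 / t \<le> real K + 1"
    using t unfolding K_def by (simp_all add: of_nat_nat)
  have part: "1 / (2 * t) \<le> real k / (exp (real k * t) - 1)" if "k \<ge> 2" "k \<le> K" for k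
  proof -
    have "real k \<le> 1 / t" using that K by linarith
    hence kt: "real k * t \<le> 1" using t by (simp add: field_simps)
    have kt0: "real k * t > 0" using t that by simp
    have "exp (real k * t) \<le> 1 + real k * t + (real k * t)\<^sup>2" using kt kt0 by (intro exp_bound) auto
    moreover have "(real k * t)\<^sup>2 \<le> real k * t" using mult_left_mono[OF kt, of "real k * t"] kt0 by (simp only: power2_eq_square mult_1_right)
    ultimately have "exp (real k * t) - 1 \<le> 2 * (real k * t)" by linarith
    moreover have "exp (real k * t) - 1 > 0" using kt0 by simp
    ultimately show ?thesis using t by (simp add: field_simps)
  qed
  have "(\<Sum>k=2..min n K. 1 / (2 * t)) \<le> (\<Sum>k=2..min n K. real k / (exp (real k * t) - 1))"
    using part by (intro sum_mono) auto
  also have "\<dots> \<le> (\<Sum>k=2..n. real k / (exp (real k * t) - 1))"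
    using t by (intro sum_mono2) auto
  also have "\<dots> = real n" using assms by (simp add: saddle_equation_def)
  finally have main: "(real (min n K) - 1) / (2 * t) \<le> real n"
  proof -
    assume "(\<Sum>k=2..min n K. 1 / (2 * t)) \<le> real n"
    moreover have "(real (min n K) - 1) / (2 * t) \<le> (\<Sum>k=2..min n K. 1 / (2 * t))"
      using t by (simp add: divide_right_mono)
    ultimately show ?thesis by linarith
  qed
  \<comment> \<open>If all k <= n satisfied k t <= 1, then n (n - 1) <= (n - 1) / t <= 2 n, which is
    impossible for n >= 4.\<close>
  have Kn: "K < n"
  proof (rule ccontr)
    assume "\<not> K < n"
    hence nK: "n \<le> K" by simp
    hence "real n \<le> 1 / t" using K by linarith
    have "(real n - 1) * real n \<le> (real n - 1) * (1 / t)"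
      using \<open>real n \<le> 1 / t\<close> assms by (intro mult_left_mono) auto
    also have "\<dots> \<le> 2 * real n" using main nK t by (simp add: field_simps min_def split: if_splits)
    finally have "real n - 1 \<le> 2" using assms by (simp add: field_simps)
    thus False using assms by simp
  qed
  thus "1 / t \<le> real n" using K by linarith
  have "(1 / t - 2) / (2 * t) \<le> (real K - 1) / (2 * t)"
    using K t by (intro divide_right_mono) auto
  also have "\<dots> \<le> real n" using main Kn by simp
  finally have "(1 - 2 * t) / 2 \<le> real n * t\<^sup>2"
    using t by (simp add: field_simps power2_eq_square)
  thus "1/4 \<le> real n * t\<^sup>2" using assms by simp
qed


lemma saddle_limit:
  assumes t: "\<And>n. n \<ge> 2 \<Longrightarrow> saddle_equation n (t n)"
  shows "t \<longlonglongrightarrow> 0" "(\<lambda>n. real n * (t n)\<^sup>2) \<longlonglongrightarrow> pi\<^sup>2 / 6"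
proof -
  have pos: "t n > 0" if "n \<ge> 2" for n using t[OF that] by (simp add: saddle_equation_def)
  have up: "t n \<le> 2 / sqrt (real n)" if n: "n \<ge> 2" for n
  proof -
    have "(sqrt (real n) * t n)\<^sup>2 \<le> pi\<^sup>2 / 6"
      using saddle_upper[OF t[OF n]] by (simp add: power_mult_distrib)
    also have "\<dots> \<le> 4 * 4 / 6" using pi_less_4 pi_gt_zero unfolding power2_eq_square
      by (intro divide_right_mono mult_mono) auto
    also have "\<dots> \<le> 2\<^sup>2" by simp
    finally have "sqrt (real n) * t n \<le> 2" by (rule power2_le_imp_le) simp
    thus ?thesis using n by (simp add: field_simps)
  qed
  show lim0: "t \<longlonglongrightarrow> 0"
  proof (rule tendsto_sandwich)
    show "(\<lambda>_. 0) \<longlonglongrightarrow> (0::real)" by simp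
    show "(\<lambda>n. 2 / sqrt (real n)) \<longlonglongrightarrow> 0" by real_asymp
    show "\<forall>\<^sub>F n in sequentially. 0 \<le> t n"
      using eventually_ge_at_top[of 2] by eventually_elim (use pos in \<open>force intro: less_imp_le\<close>)
    show "\<forall>\<^sub>F n in sequentially. t n \<le> 2 / sqrt (real n)"
      using eventually_ge_at_top[of 2] by eventually_elim (use up in auto)
  qed
  have right0: "filterlim t (at_right 0) sequentially"
    unfolding filterlim_at using lim0
    by (auto intro!: eventually_mono[OF eventually_ge_at_top[of 2]] dest: pos)
  have "\<forall>\<^sub>F n in sequentially. t n \<le> 1/4"
    using order_tendstoD(2)[OF lim0, of "1/4"] by (auto elim: eventually_mono)
  \<comment> \<open>So n t grows at least like sqrt n / 2, and the terms with x^n caused by the cut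
    vanish below.\<close>
  hence low: "\<forall>\<^sub>F n in sequentially. sqrt (real n) / 2 \<le> real n * t n"
    using eventually_ge_at_top[of 4]
  proof eventually_elim
    case (elim n)
    have "1/4 \<le> real n * (t n)\<^sup>2" using elim t[of n] by (intro saddle_lower) auto
    hence "(1/2)\<^sup>2 \<le> (sqrt (real n) * t n)\<^sup>2" by (simp add: power_mult_distrib power_divide)
    hence "1/2 \<le> sqrt (real n) * t n" by (rule power2_le_imp_le) (use pos[of n] elim in auto)
    hence "sqrt (real n) * (1/2) \<le> sqrt (real n) * (sqrt (real n) * t n)" by (intro mult_left_mono) auto
    also have "sqrt (real n) * (sqrt (real n) * t n) = real n * t n"
      by (metis abs_of_nat mult.assoc real_sqrt_mult_self)
    finally show ?case by simp
  qed
  define A where "A = (\<lambda>m n. (t n)\<^sup>2 * (\<Sum>k=2..n. real k * exp (- (real (Suc m) * t n)) ^ k))"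
  have "(\<lambda>n. A m n) \<longlonglongrightarrow> 1 / (real m + 1)\<^sup>2" for m
  proof -
    define x where "x = (\<lambda>n. exp (- (real (Suc m) * t n)))"
    have xlim: "x \<longlonglongrightarrow> 1"
      unfolding x_def using tendsto_exp[OF tendsto_minus[OF tendsto_mult_right_zero[OF lim0]]] by simp
    have quot: "(\<lambda>n. t n / (1 - x n)) \<longlonglongrightarrow> inverse (real (Suc m))"
    proof -
      have *: "((\<lambda>t. t / (1 - exp (- (c * t)))) \<longlongrightarrow> inverse c) (at_right 0)" if "c > 0" for c :: real
        using that by real_asymp
      show ?thesis
        unfolding x_def by (rule filterlim_compose[OF * right0]) simp
    qed
    have small: "(\<lambda>n. (real n + 1) * x n ^ n) \<longlonglongrightarrow> 0"
    proof (rule tendsto_sandwich)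
      show "(\<lambda>_. 0) \<longlonglongrightarrow> (0::real)" by simp
      show "(\<lambda>n. (real n + 1) * exp (- (sqrt (real n) / 2))) \<longlonglongrightarrow> 0" by real_asymp
      show "\<forall>\<^sub>F n in sequentially. 0 \<le> (real n + 1) * x n ^ n" by (simp add: x_def)
      show "\<forall>\<^sub>F n in sequentially. (real n + 1) * x n ^ n \<le> (real n + 1) * exp (- (sqrt (real n) / 2))"
        using low eventually_ge_at_top[of 2]
      proof eventually_elim
        case (elim n)
        have "x n ^ n = exp (- (real (Suc m) * (real n * t n)))"
          by (simp add: x_def algebra_simps flip: exp_of_nat_mult)
        also have "\<dots> \<le> exp (- (1 * (real n * t n)))"
          using pos[of n] elim by (simp only: exp_le_cancel_iff neg_le_iff_le) (intro mult_right_mono, auto)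
        also have "\<dots> \<le> exp (- (sqrt (real n) / 2))" using elim by simp
        finally show ?case by (intro mult_left_mono) auto
      qed
    qed
    have small': "(\<lambda>n. real n * x n ^ Suc n) \<longlonglongrightarrow> 0"
    proof (rule tendsto_sandwich[OF _ _ tendsto_const small])
      show "\<forall>\<^sub>F n in sequentially. 0 \<le> real n * x n ^ Suc n" by (simp add: x_def)
      show "\<forall>\<^sub>F n in sequentially. real n * x n ^ Suc n \<le> (real n + 1) * x n ^ n"
        using eventually_ge_at_top[of 2]
      proof eventually_elim
        case (elim n)
        have "x n \<le> 1" "x n > 0" using pos[OF elim] by (auto simp: x_def)
        thus ?case by (intro mult_mono) (auto simp: mult_le_cancel_right1)
      qed
    qed
    \<comment> \<open>The subtracted term is the summand k = 1, present in the closed form but not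
      in the saddle point equation. It tends to 0, so excluding the part 1 does not change the
      constant.\<close>
    have "(\<lambda>n. (t n / (1 - x n))\<^sup>2 * (x n * (1 - (real n + 1) * x n ^ n + real n * x n ^ Suc n)) - (t n)\<^sup>2 * x n)
       \<longlonglongrightarrow> (inverse (real (Suc m)))\<^sup>2 * (1 * (1 - 0 + 0)) - 0\<^sup>2 * 1"
      by (intro tendsto_intros quot xlim small small' lim0)
    moreover have "\<forall>\<^sub>F n in sequentially. (t n / (1 - x n))\<^sup>2 * (x n * (1 - (real n + 1) * x n ^ n + real n * x n ^ Suc n)) - (t n)\<^sup>2 * x n = A m n"
      using eventually_ge_at_top[of 2]
    proof eventually_elim
      case (elim n)
      have "x n \<noteq> 1" using pos[OF elim] by (auto simp: x_def)
      moreover have "(\<Sum>k=1..n. real k * x n ^ k) = x n + (\<Sum>k=2..n. real k * x n ^ k)"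
        using elim by (subst sum.atLeast_Suc_atMost) (auto simp: numeral_2_eq_2)
      ultimately have "(\<Sum>k=2..n. real k * x n ^ k) = x n * (1 - (real n + 1) * x n ^ n + real n * x n ^ Suc n) / (1 - x n)\<^sup>2 - x n"
        using sum_of_nat_power_eq[of "x n" n] by linarith
      moreover have "A m n = (t n)\<^sup>2 * (\<Sum>k=2..n. real k * x n ^ k)"
        unfolding A_def x_def ..
      ultimately show ?case by (simp only: power_divide right_diff_distrib times_divide_eq_left times_divide_eq_right)
    qed
    ultimately have "(\<lambda>n. A m n) \<longlonglongrightarrow> (inverse (real (Suc m)))\<^sup>2 * (1 * (1 - 0 + 0)) - 0\<^sup>2 * 1"
      by (rule Lim_transform_eventually)
    thus ?thesis by (simp add: divide_inverse power_inverse add_ac)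
  qed
  moreover have "\<forall>\<^sub>F (m, n) in sequentially \<times>\<^sub>F sequentially. norm (A m n) \<le> 1 / (real m + 1)\<^sup>2"
  proof -
    have "norm (A m n) \<le> 1 / (real m + 1)\<^sup>2" if "n \<ge> 2" for m n
    proof -
      have "A m n \<ge> 0" unfolding A_def by (intro mult_nonneg_nonneg sum_nonneg) auto
      moreover have "A m n \<le> (t n)\<^sup>2 * (1 / (real (Suc m) * t n)\<^sup>2)"
        unfolding A_def using saddle_term_bound[OF pos[OF that]] by (intro mult_left_mono) auto
      moreover have "(t n)\<^sup>2 * (1 / (real (Suc m) * t n)\<^sup>2) = 1 / (real m + 1)\<^sup>2"
        using pos[OF that] by (simp add: power_mult_distrib add_ac)
      ultimately show ?thesis by simp
    qed
    moreover have "\<forall>\<^sub>F x in sequentially \<times>\<^sub>F sequentially. True \<and> snd x \<ge> (2::nat)"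
      by (rule eventually_prodI[OF always_eventually[OF allI[OF TrueI]] eventually_ge_at_top])
    ultimately show ?thesis by (auto elim: eventually_mono)
  qed
  moreover have sq: "(\<lambda>m. 1 / (real m + 1)\<^sup>2) sums (pi\<^sup>2 / 6)"
    using inverse_squares_sums by (simp add: add_ac)
  ultimately have "(\<lambda>n. \<Sum>m. A m n) \<longlonglongrightarrow> (\<Sum>m. 1 / (real m + 1)\<^sup>2)"
    using tannerys_theorem[of A "\<lambda>m. 1 / (real m + 1)\<^sup>2" sequentially "\<lambda>m. 1 / (real m + 1)\<^sup>2"]
    by (auto simp: sums_iff)
  also have "(\<Sum>m. 1 / (real m + 1)\<^sup>2) = pi\<^sup>2 / 6" using sq by (simp add: sums_iff)
  finally have "(\<lambda>n. \<Sum>m. A m n) \<longlonglongrightarrow> pi\<^sup>2 / 6" .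
  moreover have "\<forall>\<^sub>F n in sequentially. (\<Sum>m. A m n) = real n * (t n)\<^sup>2"
    using eventually_ge_at_top[of 2]
  proof eventually_elim
    case (elim n)
    from sums_mult[OF saddle_sums[OF t[OF elim]], of "(t n)\<^sup>2"] show ?case
      unfolding A_def by (simp add: sums_iff mult.commute)
  qed
  ultimately show "(\<lambda>n. real n * (t n)\<^sup>2) \<longlonglongrightarrow> pi\<^sup>2 / 6"
    by (rule Lim_transform_eventually)
qed

section \<open>Expansion at the saddle point\<close>

text \<open>A sum of principal logarithms rather than the logarithm of the product: for Re s > 0
  each 1 - e^(-ks) has positive real part, so every summand is holomorphic and no branch has to be
  tracked.\<close>

definition partition_log :: "nat \<Rightarrow> complex \<Rightarrow> complex" where
  "partition_log N s = (\<Sum>k=2..N. - Ln (1 - exp (- (of_nat k * s))))"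

text \<open>The second derivative of \<open>partition_log\<close> at t; also the variance of the
  size of a random partition whose parts k have independent geometric multiplicities with parameter
  e^(-kt).\<close>

definition partition_variance :: "nat \<Rightarrow> real \<Rightarrow> real" where
  "partition_variance N t = (\<Sum>k=2..N. real k ^ 2 * exp (- (real k * t)) / (1 - exp (- (real k * t))) ^ 2)"

lemma exp_minus_of_nat_mult_norm_less_1:
  assumes "Re s > 0" "k \<ge> 2"
  shows "norm (exp (- (of_nat k * s)) :: complex) < 1"
  using assms by simp

lemma exp_minus_of_nat_mult_neq_1:
  assumes "Re s > 0" "k \<ge> 2"
  shows "exp (- (of_nat k * s)) \<noteq> (1::complex)"
  using exp_minus_of_nat_mult_norm_less_1[OF assms] by (metis norm_one less_irrefl)

lemma one_minus_not_nonpos_Reals: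
  assumes "norm (w::complex) < 1"
  shows "1 - w \<notin> \<real>\<^sub>\<le>\<^sub>0"
proof -
  have "Re w < 1" using assms complex_Re_le_cmod[of w] by linarith
  thus ?thesis by (auto simp: complex_nonpos_Reals_iff)
qed

lemma exp_partition_log:
  assumes "Re s > 0"
  shows "exp (partition_log N s) = partition_prod N (exp (- s))"
proof -
  have "exp (- Ln (1 - exp (- (of_nat k * s)))) = 1 / (1 - exp (- s) ^ k)" if "k \<in> {2..N}" for k
    using exp_minus_of_nat_mult_neq_1[OF assms, of k] that
    by (simp add: exp_minus[of "Ln _"] inverse_eq_divide flip: exp_of_nat_mult)
  thus ?thesis
    unfolding partition_log_def partition_prod_def exp_sum[OF finite_atLeastAtMost]
    by (intro prod.cong) auto
qed

text \<open>The point t - i \<theta> corresponds to z = e^(-t) e^(i \<theta>). Along the line Re s =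
  t the modulus of e^(-ks) is constant, so one bound by real sums controls the third derivative for
  all \<theta>.\<close>

lemma partition_log_Taylor:
  fixes t \<theta> :: real
  assumes t: "t > 0"
  defines "e \<equiv> \<lambda>k. exp (- (real k * t))"
  shows "norm (partition_log N (Complex t (- \<theta>)) - partition_log N (of_real t)
      - (\<i> * of_real (\<theta> * (\<Sum>k=2..N. real k * e k / (1 - e k))) - of_real (\<theta>\<^sup>2 * partition_variance N t / 2)))
     \<le> (\<Sum>k=2..N. 2 * (real k ^ 3 * e k / (1 - e k) ^ 3)) * \<bar>\<theta>\<bar> ^ 3 / 2"
proof -
  define E where "E = (\<lambda>k s. exp (- (of_nat k * s)) :: complex)"
  define f where "f = (\<lambda>i::nat. if i = 0 then partition_log N
    else if i = 1 then (\<lambda>s. \<Sum>k=2..N. - (of_nat k * E k s / (1 - E k s)))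
    else if i = 2 then (\<lambda>s. \<Sum>k=2..N. of_nat k ^ 2 * E k s / (1 - E k s) ^ 2)
    else (\<lambda>s. \<Sum>k=2..N. - (of_nat k ^ 3 * E k s * (1 + E k s) / (1 - E k s) ^ 3)))"
  define S where "S = {s. Re s = t}"
  have E_deriv: "(E k has_field_derivative (- of_nat k * E k s)) (at s within S)" for k s
    unfolding E_def by (auto intro!: derivative_eq_intros)
  have Elt: "norm (E k s) < 1" and Ene: "1 - E k s \<noteq> 0" and Enp: "1 - E k s \<notin> \<real>\<^sub>\<le>\<^sub>0"
    and Enorm: "norm (E k s) = e k" if "k \<in> {2..N}" "s \<in> S" for k s
  proof -
    show lt: "norm (E k s) < 1" using that t unfolding E_def S_def
      by (intro exp_minus_of_nat_mult_norm_less_1) auto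
    thus "1 - E k s \<noteq> 0" by auto
    show "1 - E k s \<notin> \<real>\<^sub>\<le>\<^sub>0" using lt by (rule one_minus_not_nonpos_Reals)
    show "norm (E k s) = e k" using that by (simp add: E_def e_def S_def)
  qed
  have f3: "f 3 = (\<lambda>s. \<Sum>k=2..N. - (of_nat k ^ 3 * E k s * (1 + E k s) / (1 - E k s) ^ 3))"
    by (simp add: f_def)
  have conv: "convex S"
    unfolding S_def convex_alt by (auto simp: algebra_simps)
  have deriv: "(f i has_field_derivative f (Suc i) s) (at s within S)" if s: "s \<in> S" and i: "i \<le> 2" for i s
  proof -
    consider "i = 0" | "i = 1" | "i = 2" using i by linarith
    thus ?thesis
    proof cases
      case 1
      have "((\<lambda>s. \<Sum>k=2..N. - Ln (1 - E k s)) has_field_derivative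
         (\<Sum>k=2..N. - (of_nat k * E k s / (1 - E k s)))) (at s within S)"
      proof (rule DERIV_sum)
        fix k assume k: "k \<in> {2..N}"
        show "((\<lambda>s. - Ln (1 - E k s)) has_field_derivative - (of_nat k * E k s / (1 - E k s))) (at s within S)"
          using Enp[OF k s] Ene[OF k s]
          by (auto intro!: derivative_eq_intros E_deriv simp: field_simps)
      qed
      moreover have "f 0 = (\<lambda>s. \<Sum>k=2..N. - Ln (1 - E k s))"
        by (auto simp: f_def partition_log_def E_def)
      ultimately show ?thesis using 1 by (simp add: f_def)
    next
      case 2
      have "((\<lambda>s. \<Sum>k=2..N. - (of_nat k * E k s / (1 - E k s))) has_field_derivative
         (\<Sum>k=2..N. of_nat k ^ 2 * E k s / (1 - E k s) ^ 2)) (at s within S)"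
      proof (rule DERIV_sum)
        fix k assume k: "k \<in> {2..N}"
        show "((\<lambda>s. - (of_nat k * E k s / (1 - E k s))) has_field_derivative of_nat k ^ 2 * E k s / (1 - E k s) ^ 2) (at s within S)"
          using Ene[OF k s]
          by (auto intro!: derivative_eq_intros E_deriv simp: field_simps power2_eq_square)
      qed
      thus ?thesis using 2 by (simp add: f_def)
    next
      case 3
      have "((\<lambda>s. \<Sum>k=2..N. of_nat k ^ 2 * E k s / (1 - E k s) ^ 2) has_field_derivative
         (\<Sum>k=2..N. - (of_nat k ^ 3 * E k s * (1 + E k s) / (1 - E k s) ^ 3))) (at s within S)"
      proof (rule DERIV_sum)
        fix k assume k: "k \<in> {2..N}"
        define w where "w = E k s"
        have w: "1 - w \<noteq> 0" using Ene[OF k s] by (simp add: w_def)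
        have "((\<lambda>s. of_nat k ^ 2 * E k s / (1 - E k s) ^ 2) has_field_derivative
           (of_nat k ^ 2 * (- of_nat k * w) * (1 - w) ^ 2 - of_nat k ^ 2 * w * (2 * (1 - w) * (of_nat k * w))) / ((1 - w) ^ 2 * (1 - w) ^ 2)) (at s within S)"
          using w unfolding w_def by (auto intro!: derivative_eq_intros E_deriv)
        \<comment> \<open>The quotient rule leaves a surplus factor 1 - w in numerator and
          denominator.\<close>
        also have "(of_nat k ^ 2 * (- of_nat k * w) * (1 - w) ^ 2 - of_nat k ^ 2 * w * (2 * (1 - w) * (of_nat k * w))) / ((1 - w) ^ 2 * (1 - w) ^ 2)
           = ((1 - w) * (- (of_nat k ^ 3 * w * (1 + w)))) / ((1 - w) * (1 - w) ^ 3)"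
          by (rule arg_cong2[of _ _ _ _ "(/)"]) (simp_all add: algebra_simps power2_eq_square power3_eq_cube)
        also have "\<dots> = - (of_nat k ^ 3 * w * (1 + w) / (1 - w) ^ 3)"
          using w by (subst mult_divide_mult_cancel_left) auto
        finally show "((\<lambda>s. of_nat k ^ 2 * E k s / (1 - E k s) ^ 2) has_field_derivative
           - (of_nat k ^ 3 * E k s * (1 + E k s) / (1 - E k s) ^ 3)) (at s within S)"
          unfolding w_def .
      qed
      moreover have "f (Suc i) = f 3" using 3 by simp
      ultimately show ?thesis using 3 unfolding f3 by (simp add: f_def)
    qed
  qed
  have bound: "norm (f (Suc 2) s) \<le> (\<Sum>k=2..N. 2 * (real k ^ 3 * e k / (1 - e k) ^ 3))" if s: "s \<in> S" for s
  proof -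
    have "norm (f 3 s) \<le> (\<Sum>k=2..N. norm (- (of_nat k ^ 3 * E k s * (1 + E k s) / (1 - E k s) ^ 3)))"
      unfolding f3 by (rule norm_sum)
    also have "\<dots> \<le> (\<Sum>k=2..N. 2 * (real k ^ 3 * e k / (1 - e k) ^ 3))"
    proof (rule sum_mono)
      fix k assume k: "k \<in> {2..N}"
      have ek: "e k < 1" using Elt[OF k s] Enorm[OF k s] by simp
      have den: "1 - e k \<le> norm (1 - E k s)"
        using norm_triangle_ineq2[of 1 "E k s"] Enorm[OF k s] by simp
      have num: "norm (1 + E k s) \<le> 2"
        using norm_triangle_ineq[of 1 "E k s"] Enorm[OF k s] ek by simp
      have "norm (- (of_nat k ^ 3 * E k s * (1 + E k s) / (1 - E k s) ^ 3))
         = real k ^ 3 * e k * norm (1 + E k s) / norm (1 - E k s) ^ 3"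
        using Enorm[OF k s] by (simp add: norm_mult norm_divide norm_power)
      also have "\<dots> \<le> real k ^ 3 * e k * 2 / (1 - e k) ^ 3"
        using den num ek by (intro frac_le mult_left_mono power_mono) (auto simp: e_def)
      finally show "norm (- (of_nat k ^ 3 * E k s * (1 + E k s) / (1 - E k s) ^ 3)) \<le> 2 * (real k ^ 3 * e k / (1 - e k) ^ 3)"
        by (simp add: mult_ac)
    qed
    finally show ?thesis by (simp add: numeral_3_eq_3 numeral_2_eq_2)
  qed
  have Et: "E k (of_real t) = of_real (e k)" for k
    by (simp add: E_def e_def flip: exp_of_real)
  have f1t: "f 1 (of_real t) = - of_real (\<Sum>k=2..N. real k * e k / (1 - e k))"
    by (simp add: f_def Et sum_negf)
  have f2t: "f 2 (of_real t) = of_real (partition_variance N t)"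
    by (simp add: f_def Et partition_variance_def e_def)
  have diff: "Complex t (- \<theta>) - of_real t = - (\<i> * of_real \<theta>)"
    by (simp add: complex_eq_iff)
  \<comment> \<open>\<open>complex_Taylor\<close> divides the remainder by 2! instead of 3!, whence
    the final division by 2.\<close>
  have "norm (f 0 (Complex t (- \<theta>)) - (\<Sum>i\<le>2. f i (of_real t) * (Complex t (- \<theta>) - of_real t) ^ i / fact i))
     \<le> (\<Sum>k=2..N. 2 * (real k ^ 3 * e k / (1 - e k) ^ 3)) * norm (Complex t (- \<theta>) - of_real t) ^ Suc 2 / fact 2"
    by (rule complex_Taylor[OF conv deriv bound]) (auto simp: S_def)
  also have "norm (Complex t (- \<theta>) - of_real t) ^ Suc 2 = \<bar>\<theta>\<bar> ^ 3"
    unfolding diff by (simp add: norm_mult eval_nat_numeral)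
  also have "(\<Sum>i\<le>2. f i (of_real t) * (Complex t (- \<theta>) - of_real t) ^ i / fact i)
     = f 0 (of_real t) + f 1 (of_real t) * (- (\<i> * of_real \<theta>)) + f 2 (of_real t) * (- (\<i> * of_real \<theta>)) ^ 2 / 2"
    unfolding diff by (simp add: numeral_2_eq_2)
  also have "\<dots> = partition_log N (of_real t) + (\<i> * of_real (\<theta> * (\<Sum>k=2..N. real k * e k / (1 - e k))) - of_real (\<theta>\<^sup>2 * partition_variance N t / 2))"
    unfolding f1t f2t by (simp add: f_def power_mult_distrib algebra_simps)
  finally show ?thesis by (simp add: f_def algebra_simps)
qed

section \<open>Size of the second and third derivatives\<close>

lemma sum_exp_le:
  fixes t :: real
  assumes t: "0 < t" "t \<le> 1"
  shows "(\<Sum>k=2..N. exp (- (real k * t / 2))) \<le> 4 / t"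
proof -
  define x where "x = exp (- (t / 2))"
  have x: "0 < x" "x < 1" using t by (auto simp: x_def)
  have "(\<Sum>k=2..N. exp (- (real k * t / 2))) = (\<Sum>k=2..N. x ^ k)"
    by (intro sum.cong refl) (simp add: x_def flip: exp_of_nat_mult)
  also have "\<dots> \<le> (\<Sum>k<Suc N. x ^ k)"
    using x by (intro sum_mono2) auto
  also have "\<dots> \<le> (\<Sum>k. x ^ k)"
    using x by (intro sum_le_suminf summable_geometric) auto
  also have "\<dots> = 1 / (1 - x)"
    using x by (intro suminf_geometric) auto
  also have "\<dots> \<le> 1 / (t / 2 / (1 + t / 2))"
    using one_minus_exp_ge[of "t / 2"] t x unfolding x_def
    by (intro divide_left_mono mult_pos_pos divide_pos_pos) auto
  also have "\<dots> \<le> 4 / t" using t by (simp add: field_simps)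
  finally show ?thesis .
qed

text \<open>Half of the exponential absorbs the powers: with y = k t, (1 + y)^j e^(-y/2) <= (2j)^j.
  The other half leaves a geometric sum of size 4/t. The cases j = 2 and j = 3 give the constants 64
  and 864 used later.\<close>

lemma moment_sum_le:
  fixes t :: real
  assumes t: "0 < t" "t \<le> 1" and j: "j \<ge> 1"
  shows "(\<Sum>k=2..N. real k ^ j * exp (- (real k * t)) / (1 - exp (- (real k * t))) ^ j)
     \<le> 4 * (2 * real j) ^ j / t ^ (j + 1)"
proof -
  have "real k ^ j * exp (- (real k * t)) / (1 - exp (- (real k * t))) ^ j
      \<le> (2 * real j) ^ j / t ^ j * exp (- (real k * t / 2))" if k: "k \<in> {2..N}" for k
  proof -
    define y where "y = real k * t"
    have y: "y > 0" using k t by (simp add: y_def)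
    have "1 + y \<le> 2 * real j * (1 + y / (2 * real j))"
      using j y by (simp add: field_simps)
    also have "\<dots> \<le> 2 * real j * exp (y / (2 * real j))"
      by (intro mult_left_mono exp_ge_add_one_self) auto
    finally have "(1 + y) ^ j \<le> (2 * real j * exp (y / (2 * real j))) ^ j"
      using y by (intro power_mono) auto
    also have "\<dots> = (2 * real j) ^ j * exp (y / 2)"
      using j by (simp add: power_mult_distrib flip: exp_of_nat_mult)
    finally have pow: "(1 + y) ^ j * exp (- y) \<le> (2 * real j) ^ j * exp (y / 2) * exp (- y)"
      by (intro mult_right_mono) auto
    have "exp (y / 2) * exp (- y) = exp (- (y / 2))" by (simp flip: exp_add)
    hence pow': "(1 + y) ^ j * exp (- y) \<le> (2 * real j) ^ j * exp (- (y / 2))"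
      using pow by (simp add: mult.assoc)
    have "real k ^ j * exp (- y) / (1 - exp (- y)) ^ j \<le> real k ^ j * exp (- y) / (y / (1 + y)) ^ j"
      using one_minus_exp_ge[OF y] y
      by (intro divide_left_mono power_mono mult_pos_pos zero_less_power) auto
    also have "\<dots> = real k ^ j * ((1 + y) ^ j * exp (- y)) / y ^ j"
      by (simp add: power_divide)
    also have "\<dots> = ((1 + y) ^ j * exp (- y)) / t ^ j"
      using k by (simp add: y_def power_mult_distrib)
    also have "\<dots> \<le> ((2 * real j) ^ j * exp (- (y / 2))) / t ^ j"
      using pow' t by (intro divide_right_mono) auto
    finally show ?thesis by (simp add: y_def)
  qed
  hence "(\<Sum>k=2..N. real k ^ j * exp (- (real k * t)) / (1 - exp (- (real k * t))) ^ j)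
     \<le> (\<Sum>k=2..N. (2 * real j) ^ j / t ^ j * exp (- (real k * t / 2)))"
    by (rule sum_mono)
  also have "\<dots> = (2 * real j) ^ j / t ^ j * (\<Sum>k=2..N. exp (- (real k * t / 2)))"
    by (rule sum_distrib_left[symmetric])
  also have "\<dots> \<le> (2 * real j) ^ j / t ^ j * (4 / t)"
    using t by (intro mult_left_mono sum_exp_le) auto
  finally show ?thesis by (simp add: mult_ac)
qed

lemma partition_variance_upper:
  assumes "0 < t" "t \<le> 1"
  shows "partition_variance N t \<le> 64 / t ^ 3"
  using moment_sum_le[OF assms, of 2 N] by (simp add: partition_variance_def)

text \<open>A summand with k t <= 1 is at least 1/(3 t^2), and at least 1/(2t) such k remain from 2
  on. The hypothesis on \<open>N\<close> ensures that the cut keeps all of them.\<close>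

lemma partition_variance_lower:
  assumes t: "0 < t" "t \<le> 1/4" and N: "1 / t \<le> real N"
  shows "1 / (6 * t ^ 3) \<le> partition_variance N t"
proof -
  define K where "K = nat \<lfloor>1 / t\<rfloor>"
  have K: "real K \<le> 1 / t" "1 / t \<le> real K + 1"
    using t unfolding K_def by (simp_all add: of_nat_nat)
  have "real K \<le> real N" using K N by linarith
  hence KN: "K \<le> N" by simp
  have "1 / t \<ge> 4" using t by (simp add: field_simps)
  hence K2: "real K - 1 \<ge> 1 / (2 * t)" using K t by (simp add: field_simps)
  have "1 / (6 * t ^ 3) = 1 / (2 * t) * (1 / (3 * t\<^sup>2))" by (simp add: power2_eq_square power3_eq_cube)
  also have "\<dots> \<le> (real K - 1) * (1 / (3 * t\<^sup>2))"
    using K2 by (intro mult_right_mono) auto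
  also have "\<dots> \<le> (\<Sum>k=2..K. 1 / (3 * t\<^sup>2))"
    by (simp add: divide_right_mono)
  also have "\<dots> \<le> (\<Sum>k=2..K. real k ^ 2 * exp (- (real k * t)) / (1 - exp (- (real k * t))) ^ 2)"
  proof (rule sum_mono)
    fix k assume k: "k \<in> {2..K}"
    define y where "y = real k * t"
    have "real k \<le> 1 / t" using k K by auto
    hence y: "0 < y" "y \<le> 1" using t k by (auto simp: y_def field_simps)
    have "exp (1::real) \<le> 3" using exp_le by simp
    moreover have "exp y \<le> exp 1" using y by simp
    ultimately have "exp y \<le> 3" by linarith
    hence e: "1 / 3 \<le> exp (- y)" by (simp add: exp_minus field_simps)
    have "1 - exp (- y) \<le> y" using exp_ge_add_one_self[of "- y"] by linarith
    hence d: "(1 - exp (- y)) ^ 2 \<le> y ^ 2" using y by (intro power_mono) auto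
    have "1 / (3 * t\<^sup>2) = real k ^ 2 * (1 / 3) / y ^ 2"
      using k t by (simp add: y_def power_mult_distrib)
    also have "\<dots> \<le> real k ^ 2 * exp (- y) / (1 - exp (- y)) ^ 2"
      using e d y by (intro frac_le mult_left_mono) auto
    finally show "1 / (3 * t\<^sup>2) \<le> real k ^ 2 * exp (- (real k * t)) / (1 - exp (- (real k * t))) ^ 2"
      by (simp add: y_def)
  qed
  also have "\<dots> \<le> partition_variance N t"
    unfolding partition_variance_def using KN by (intro sum_mono2) auto
  finally show ?thesis .
qed

section \<open>Decay away from the saddle point\<close>

lemma one_minus_cos_ge:
  fixes \<theta> :: real
  assumes "\<bar>\<theta>\<bar> \<le> pi"
  shows "\<theta>\<^sup>2 / 8 \<le> 1 - cos \<theta>"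
proof -
  \<comment> \<open>A quarter of the angle, so that (cos u)^2 >= 1/2 up to |\<theta>| = pi. Then sin
    (2u) >= 2 u (cos u)^2 >= u, and 1 - cos \<theta> = 2 (sin (2u))^2.\<close>
  define u where "u = \<bar>\<theta>\<bar> / 4"
  have u: "0 \<le> u" "u \<le> pi / 4" using assms by (auto simp: u_def)
  have sin_ge: "u * cos u \<le> sin u"
  proof -
    have "((\<lambda>x. sin x - x * cos x) has_real_derivative (x * sin x)) (at x)" for x :: real
      by (auto intro!: derivative_eq_intros)
    moreover have "x * sin x \<ge> 0" if "0 \<le> x" "x \<le> u" for x
      using that u pi_gt_zero by (intro mult_nonneg_nonneg sin_ge_zero) auto
    ultimately have "sin 0 - 0 * cos 0 \<le> sin u - u * cos u"
      by (intro DERIV_nonneg_imp_nondecreasing[OF u(1), of "\<lambda>x. sin x - x * cos x"]) blast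
    thus ?thesis by simp
  qed
  have "cos (pi / 4) \<le> cos u" using u pi_gt_zero by (intro cos_monotone_0_pi_le) auto
  hence c: "sqrt 2 / 2 \<le> cos u" by (simp add: cos_45)
  hence "(sqrt 2 / 2) ^ 2 \<le> (cos u) ^ 2" by (intro power_mono) auto
  hence c2: "1 / 2 \<le> (cos u)\<^sup>2" by (simp add: power_divide)
  have c0: "0 \<le> cos u" using c by (rule order_trans[rotated]) simp
  have "u \<le> 2 * u * (cos u)\<^sup>2" using mult_left_mono[OF c2, of "2 * u"] u by simp
  also have "\<dots> = 2 * (u * cos u) * cos u" by (simp add: power2_eq_square)
  also have "\<dots> \<le> 2 * sin u * cos u" using sin_ge c0 by (intro mult_right_mono) auto
  also have "\<dots> = sin (2 * u)" by (simp add: sin_double)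
  finally have "u\<^sup>2 \<le> (sin (2 * u))\<^sup>2" using u by (intro power_mono) auto
  moreover have "cos \<theta> = 1 - 2 * (sin (2 * u))\<^sup>2"
  proof -
    have "cos \<theta> = cos (2 * (2 * u))" by (simp add: u_def)
    thus ?thesis by (simp only: cos_double_sin)
  qed
  moreover have "u\<^sup>2 = \<theta>\<^sup>2 / 16" by (simp add: u_def power_divide)
  ultimately show ?thesis by simp
qed

text \<open>Based on |1 - w|^2 = (1 - x)^2 + 2 (x - Re w). The exponent is linear in x - Re w on
  purpose: for w = z^k the product over k then leads to geometric sums.\<close>

lemma geometric_factor_bound:
  fixes w :: complex
  assumes w: "norm w < 1"
  defines "x \<equiv> norm w"
  shows "(1 - x) / norm (1 - w) \<le> exp (- ((x - Re w) / 5))"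
proof -
  define y where "y = x - Re w"
  have x: "0 \<le> x" "x < 1" using w by (auto simp: x_def)
  have y: "0 \<le> y" "y \<le> 2"
    using complex_Re_le_cmod[of w] abs_Re_le_cmod[of w] w unfolding y_def x_def by linarith+
  have sq: "(norm (1 - w))\<^sup>2 = (1 - x)\<^sup>2 + 2 * y"
  proof -
    have "(norm (1 - w))\<^sup>2 = 1 - 2 * Re w + ((Re w)\<^sup>2 + (Im w)\<^sup>2)"
      unfolding cmod_power2 by (simp add: power2_eq_square algebra_simps)
    also have "(Re w)\<^sup>2 + (Im w)\<^sup>2 = x\<^sup>2" by (simp add: x_def cmod_power2)
    finally show ?thesis by (simp add: y_def power2_eq_square algebra_simps)
  qed
  \<comment> \<open>As y <= 2, the divisor 5 keeps the exponent below 1, where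
    \<open>exp_bound\<close> applies.\<close>
  have "exp (2 * y / 5) \<le> 1 + 2 * y / 5 + (2 * y / 5)\<^sup>2"
    using y by (intro exp_bound) auto
  also have "(2 * y / 5)\<^sup>2 \<le> 2 * y / 5 * 1"
    unfolding power2_eq_square using y by (intro mult_left_mono) auto
  finally have e: "exp (2 * y / 5) \<le> 1 + 2 * y" using y by simp
  have "(1 - x)\<^sup>2 * exp (2 * y / 5) \<le> (1 - x)\<^sup>2 * (1 + 2 * y)"
    using e by (intro mult_left_mono) auto
  also have "\<dots> = (1 - x)\<^sup>2 + (1 - x)\<^sup>2 * (2 * y)" by (simp add: algebra_simps)
  also have "(1 - x)\<^sup>2 * (2 * y) \<le> 1 * (2 * y)"
    using x y by (intro mult_right_mono) (auto intro: power_le_one)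
  finally have "((1 - x) * exp (y / 5))\<^sup>2 \<le> (norm (1 - w))\<^sup>2"
    using sq by (simp add: power_mult_distrib flip: exp_double)
  hence "(1 - x) * exp (y / 5) \<le> norm (1 - w)" by (rule power2_le_imp_le) simp
  moreover have "norm (1 - w) > 0" using w by auto
  ultimately show ?thesis unfolding y_def[symmetric] by (simp add: exp_minus field_simps)
qed

text \<open>The left-hand side is \<open>\<Sum>k. q^k - Re (z^k)\<close>, so only a closed form has to be estimated, for all
  \<open>\<theta>\<close> at once; there is no separate treatment of minor arcs.\<close>

lemma Re_inverse_one_minus_diff:
  fixes q \<theta> :: real
  assumes q: "0 < q" "q < 1"
  defines "z \<equiv> of_real q * cis \<theta>" and "S \<equiv> 1 - cos \<theta>"
  shows "1 / (1 - q) - Re (1 / (1 - z)) = q * (1 + q) * S / ((1 - q) * ((1 - q)\<^sup>2 + 2 * q * S))"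
proof -
  have S0: "S \<ge> 0" by (simp add: S_def)
  have "(Re (1 - z))\<^sup>2 + (Im (1 - z))\<^sup>2 = (1 - q * cos \<theta>)\<^sup>2 + (q * sin \<theta>)\<^sup>2"
    by (simp add: z_def)
  also have "\<dots> = 1 - 2 * q * cos \<theta> + q\<^sup>2 * ((cos \<theta>)\<^sup>2 + (sin \<theta>)\<^sup>2)"
    by algebra
  also have "\<dots> = (1 - q)\<^sup>2 + 2 * q * S"
    by (simp add: S_def power2_eq_square algebra_simps)
  finally have den: "(Re (1 - z))\<^sup>2 + (Im (1 - z))\<^sup>2 = (1 - q)\<^sup>2 + 2 * q * S" .
  have num: "Re (1 - z) = (1 - q) + q * S" by (simp add: z_def S_def algebra_simps)
  have pos: "(1 - q)\<^sup>2 + 2 * q * S > 0" using q S0 by (intro add_pos_nonneg) auto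
  have "Re (1 / (1 - z)) = ((1 - q) + q * S) / ((1 - q)\<^sup>2 + 2 * q * S)"
    using den num by (simp add: Re_divide)
  hence "1 / (1 - q) - Re (1 / (1 - z))
     = (((1 - q)\<^sup>2 + 2 * q * S) - ((1 - q) + q * S) * (1 - q)) / ((1 - q) * ((1 - q)\<^sup>2 + 2 * q * S))"
    using pos q by (simp add: diff_frac_eq)
  also have "((1 - q)\<^sup>2 + 2 * q * S) - ((1 - q) + q * S) * (1 - q) = q * (1 + q) * S"
    by (simp add: power2_eq_square algebra_simps)
  finally show ?thesis .
qed

text \<open>The full geometric series minus what the range omits: k = 0 contributes 0, k = 1 at most
  2, and the indices beyond N at most 2 q^(N+1) / (1 - q).\<close>

lemma sum_power_diff_ge:
  fixes q \<theta> :: real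
  assumes q: "0 < q" "q < 1" and N: "N \<ge> 1"
  defines "z \<equiv> of_real q * cis \<theta>"
  shows "(\<Sum>k=2..N. q ^ k - Re (z ^ k)) \<ge> 1 / (1 - q) - Re (1 / (1 - z)) - 2 - 2 * q ^ Suc N / (1 - q)"
proof -
  have nz: "norm z = q" using q by (simp add: z_def norm_mult)
  hence z1: "z \<noteq> 1" using q by auto
  have "(\<Sum>k<Suc N. q ^ k - Re (z ^ k)) = (q ^ 0 - Re (z ^ 0)) + (q ^ 1 - Re (z ^ 1)) + (\<Sum>k=2..N. q ^ k - Re (z ^ k))"
  proof -
    have "{..<Suc N} = {0, 1} \<union> {2..N}" using N by auto
    thus ?thesis by (simp only:) (subst sum.union_disjoint, auto)
  qed
  moreover have "q - Re z \<le> 2" using abs_Re_le_cmod[of z] nz q by linarith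
  moreover have "(\<Sum>k<Suc N. q ^ k - Re (z ^ k)) = (1 - q ^ Suc N) / (1 - q) - Re ((1 - z ^ Suc N) / (1 - z))"
  proof -
    have "(\<Sum>k<Suc N. q ^ k) = (1 - q ^ Suc N) / (1 - q)"
      using sum_gp_strict[of q "Suc N"] q by simp
    moreover have "(\<Sum>k<Suc N. z ^ k) = (1 - z ^ Suc N) / (1 - z)"
      using sum_gp_strict[of z "Suc N"] z1 by (simp only: if_False)
    ultimately show ?thesis by (simp only: sum_subtractf flip: Re_sum)
  qed
  moreover have "(1 - q ^ Suc N) / (1 - q) = 1 / (1 - q) - q ^ Suc N / (1 - q)"
    by (rule diff_divide_distrib)
  moreover have "Re ((1 - z ^ Suc N) / (1 - z)) = Re (1 / (1 - z)) - Re (z ^ Suc N / (1 - z))"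
    by (simp only: diff_divide_distrib minus_complex.simps)
  moreover have "- Re (z ^ Suc N / (1 - z)) \<le> q ^ Suc N / (1 - q)"
  proof -
    have "- Re (z ^ Suc N / (1 - z)) \<le> norm (z ^ Suc N / (1 - z))"
      using abs_Re_le_cmod[of "z ^ Suc N / (1 - z)"] by linarith
    also have "\<dots> = q ^ Suc N / norm (1 - z)" by (simp only: norm_divide norm_power nz)
    also have "\<dots> \<le> q ^ Suc N / (1 - q)"
      using norm_triangle_ineq2[of 1 z] nz q by (intro divide_left_mono mult_pos_pos) auto
    finally show ?thesis .
  qed
  ultimately show ?thesis by simp
qed

text \<open>For |\<theta>| <= t the decay exponent has order \<theta>^2 / t^3, as the Gaussian does;
  for larger angles it stays of order 1/t. The hypothesis \<open>tail\<close> limits the cost of the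
  cut to a constant.\<close>

lemma partition_prod_ratio_bound:
  fixes t \<theta> :: real
  assumes t: "0 < t" "t \<le> 1/4" and \<theta>: "\<bar>\<theta>\<bar> \<le> pi" and N: "N \<ge> 1" and tail: "exp (- (real N * t)) \<le> t"
  defines "q \<equiv> exp (- t)"
  shows "norm (partition_prod N (of_real q * cis \<theta>) / partition_prod N (of_real q))
     \<le> exp (1 - \<theta>\<^sup>2 / (60 * t * (t\<^sup>2 + \<theta>\<^sup>2)))"
proof -
  define z where "z = of_real q * cis \<theta>"
  define S where "S = 1 - cos \<theta>"
  have q: "0 < q" "q < 1" using t by (auto simp: q_def)
  have nz: "norm z = q" using q by (simp add: z_def norm_mult)
  have "norm (partition_prod N z / partition_prod N (of_real q)) = (\<Prod>k=2..N. (1 - q ^ k) / norm (1 - z ^ k))"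
    unfolding partition_prod_def prod_dividef[symmetric] prod_norm[symmetric]
  proof (intro prod.cong refl)
    fix k assume "k \<in> {2..N}"
    hence "q ^ k < 1" using q by (simp add: power_less_one_iff)
    hence "norm (1 - of_real q ^ k :: complex) = 1 - q ^ k"
      by (metis abs_of_pos diff_gt_0_iff_gt norm_of_real of_real_1 of_real_diff of_real_power)
    thus "norm (1 / (1 - z ^ k) / (1 / (1 - of_real q ^ k))) = (1 - q ^ k) / norm (1 - z ^ k)"
      by (simp add: norm_divide)
  qed
  also have "\<dots> \<le> (\<Prod>k=2..N. exp (- ((q ^ k - Re (z ^ k)) / 5)))"
  proof (intro prod_mono conjI)
    fix k assume k: "k \<in> {2..N}"
    hence qk: "q ^ k < 1" using q by (simp add: power_less_one_iff)
    thus "0 \<le> (1 - q ^ k) / norm (1 - z ^ k)" by simp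
    show "(1 - q ^ k) / norm (1 - z ^ k) \<le> exp (- ((q ^ k - Re (z ^ k)) / 5))"
      using geometric_factor_bound[of "z ^ k"] qk nz by (simp add: norm_power)
  qed
  also have "\<dots> = exp (- ((\<Sum>k=2..N. q ^ k - Re (z ^ k)) / 5))"
    by (simp only: exp_sum[OF finite_atLeastAtMost, symmetric] sum_negf sum_divide_distrib)
  also have "\<dots> \<le> exp (1 - \<theta>\<^sup>2 / (60 * t * (t\<^sup>2 + \<theta>\<^sup>2)))"
  proof -
    have "q ^ Suc N = exp (- (real N * t)) * q"
      by (simp add: q_def mult.commute flip: exp_of_nat_mult)
    also have "\<dots> \<le> t * q" using tail q by (intro mult_right_mono) auto
    also have "t * q \<le> 1 - q"
    proof -
      have "t + 1 \<le> exp t" using exp_ge_add_one_self[of t] by linarith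
      hence "(t + 1) * q \<le> exp t * q" using q by (intro mult_right_mono) auto
      also have "exp t * q = 1" by (simp add: q_def flip: exp_add)
      finally show ?thesis by (simp add: algebra_simps)
    qed
    finally have tail2: "q ^ Suc N / (1 - q) \<le> 1" using q by simp
    have "1 - t \<le> q" using exp_ge_add_one_self[of "- t"] by (simp add: q_def)
    hence q34: "3 / 4 \<le> q" and a: "1 - q \<le> t" using t by auto
    have S: "\<theta>\<^sup>2 / 8 \<le> S" using one_minus_cos_ge[OF \<theta>] by (simp add: S_def)
    have S0: "0 \<le> S" by (simp add: S_def)
    have "3 / 32 * (\<theta>\<^sup>2 / (t * (t\<^sup>2 + \<theta>\<^sup>2))) = 3 / 4 * ((\<theta>\<^sup>2 / 8) / (t * (t\<^sup>2 + \<theta>\<^sup>2)))" by simp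
    also have "\<dots> \<le> 3 / 4 * ((\<theta>\<^sup>2 / 8) / (t * (t\<^sup>2 + 2 * (\<theta>\<^sup>2 / 8))))"
      using t by (intro mult_left_mono divide_left_mono mult_pos_pos add_left_mono add_pos_nonneg) auto
    also have "\<dots> \<le> 3 / 4 * (S / (t * (t\<^sup>2 + 2 * S)))"
    proof (intro mult_left_mono)
      \<comment> \<open>S / (t^2 + 2 S) increases with S, so the lower bound for S may replace it in
        numerator and denominator at once.\<close>
      have "(\<theta>\<^sup>2 / 8) / (t\<^sup>2 + 2 * (\<theta>\<^sup>2 / 8)) \<le> S / (t\<^sup>2 + 2 * S)"
      proof -
        have pos: "t\<^sup>2 + 2 * (\<theta>\<^sup>2 / 8) > 0" "t\<^sup>2 + 2 * S > 0"
          using t S0 by (auto intro!: add_pos_nonneg)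
        have "(\<theta>\<^sup>2 / 8) * (t\<^sup>2 + 2 * S) \<le> S * (t\<^sup>2 + 2 * (\<theta>\<^sup>2 / 8))"
          using mult_right_mono[OF S, of "t\<^sup>2"] by (simp add: algebra_simps)
        thus ?thesis using pos by (simp only: pos_divide_le_eq pos_le_divide_eq times_divide_eq_left)
      qed
      moreover have div_t: "a / (t * b) = a / b / t" for a b :: real by (simp add: mult.commute)
      ultimately show "(\<theta>\<^sup>2 / 8) / (t * (t\<^sup>2 + 2 * (\<theta>\<^sup>2 / 8))) \<le> S / (t * (t\<^sup>2 + 2 * S))"
        using t unfolding div_t by (intro divide_right_mono) auto
    qed simp
    also have "\<dots> = (3 / 4) * S / (t * (t\<^sup>2 + 2 * S))" by simp
    also have "\<dots> \<le> (q * (1 + q)) * S / ((1 - q) * ((1 - q)\<^sup>2 + 2 * q * S))"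
    proof (intro frac_le mult_right_mono mult_mono add_mono power_mono mult_pos_pos add_pos_nonneg)
      have "3 / 4 * 1 \<le> q * (1 + q)" using q34 by (intro mult_mono) auto
      thus "3 / 4 \<le> q * (1 + q)" by simp
    qed (use q a S0 t in auto)
    also have "\<dots> = 1 / (1 - q) - Re (1 / (1 - z))"
      using Re_inverse_one_minus_diff[OF q, of \<theta>] by (simp add: z_def S_def)
    also have "\<dots> \<le> (\<Sum>k=2..N. q ^ k - Re (z ^ k)) + 4"
      using sum_power_diff_ge[OF q N, of \<theta>] tail2 by (simp add: z_def)
    finally have main: "3 / 32 * (\<theta>\<^sup>2 / (t * (t\<^sup>2 + \<theta>\<^sup>2))) \<le> (\<Sum>k=2..N. q ^ k - Re (z ^ k)) + 4" .
    \<comment> \<open>The 4 collects a loss of 2 from k = 1 and of 2 from the tail; then 4/5 <= 1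
      and 3/160 >= 1/60.\<close>
    have "- (Q / 5) \<le> 1 - R / 60" if "0 \<le> R" "3 / 32 * R \<le> Q + 4" for Q R :: real
      using that by linarith
    from this[OF _ main] t
    have "- ((\<Sum>k=2..N. q ^ k - Re (z ^ k)) / 5) \<le> 1 - \<theta>\<^sup>2 / (t * (t\<^sup>2 + \<theta>\<^sup>2)) / 60"
      by simp
    thus ?thesis by (simp add: mult_ac)
  qed
  finally show ?thesis by (simp add: z_def)
qed

text \<open>The constant \<open>A = 1024 * 120^3\<close> comes from \<open>x\<^sup>2 \<le> \<pi>\<^sup>2 V \<le> 1024 / t^3\<close>, which turns the bound
  \<open>u \<ge> 1 / (120 t)\<close> of the outer range into \<open>u^3 \<ge> x\<^sup>2 / A\<close>.\<close>

lemma dominator_bound: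
  fixes t V x :: real
  assumes t: "0 < t" and V: "0 < V" "V \<le> 64 / t ^ 3" and x: "\<bar>x\<bar> \<le> pi * sqrt V"
  defines "\<theta> \<equiv> x / sqrt V" and "A \<equiv> 1769472000"
  shows "(1 + \<bar>x\<bar>) * exp (1 - \<theta>\<^sup>2 / (60 * t * (t\<^sup>2 + \<theta>\<^sup>2))) \<le> 2 * A\<^sup>2 * 6 ^ 6 * exp 1 / (1 + x\<^sup>2)"
proof -
  define u where "u = \<theta>\<^sup>2 / (60 * t * (t\<^sup>2 + \<theta>\<^sup>2))"
  define \<rho> where "\<rho> = x\<^sup>2 / A"
  have u0: "0 \<le> u" using t by (simp add: u_def)
  have \<rho>0: "0 \<le> \<rho>" by (simp add: \<rho>_def A_def)
  have \<theta>2: "\<theta>\<^sup>2 = x\<^sup>2 / V" using V by (simp add: \<theta>_def power_divide)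
  have "u = (V * \<theta>\<^sup>2) / (V * (60 * t * (t\<^sup>2 + \<theta>\<^sup>2)))" using V by (simp add: u_def)
  also have "V * \<theta>\<^sup>2 = x\<^sup>2" using V by (simp add: \<theta>2)
  also have "V * (60 * t * (t\<^sup>2 + \<theta>\<^sup>2)) = 60 * (V * t ^ 3 + t * (V * \<theta>\<^sup>2))"
    by (simp add: algebra_simps power2_eq_square power3_eq_cube)
  also have "V * \<theta>\<^sup>2 = x\<^sup>2" using V by (simp add: \<theta>2)
  finally have u_eq: "u = x\<^sup>2 / (60 * (V * t ^ 3 + t * x\<^sup>2))" .
  have Vt: "V * t ^ 3 \<le> 64" using V t by (simp add: field_simps)
  have Vt0: "V * t ^ 3 > 0" using V t by simp
  have u_ge: "x\<^sup>2 / (60 * (64 + t * x\<^sup>2)) \<le> u"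
    unfolding u_eq using Vt Vt0 t by (intro divide_left_mono mult_pos_pos) (auto intro: add_pos_nonneg)
  \<comment> \<open>For t x^2 <= 64 one has u >= x^2 / 7680. Beyond that only u >= 1/(120 t) is
    known, while x^2 may reach order t^(-3); the third power serves both ranges.\<close>
  have cube: "1 + \<rho> \<le> (1 + u) ^ 3"
  proof (cases "t * x\<^sup>2 \<le> 64")
    case True
    have "\<rho> \<le> x\<^sup>2 / 7680" by (simp add: \<rho>_def A_def field_simps)
    also have "\<dots> \<le> x\<^sup>2 / (60 * (64 + t * x\<^sup>2))"
      using True t by (intro divide_left_mono mult_pos_pos) (auto intro: add_pos_nonneg)
    also have "\<dots> \<le> u" by (rule u_ge)
    finally have "1 + \<rho> \<le> (1 + u) ^ 1" by simp
    also have "\<dots> \<le> (1 + u) ^ 3" using u0 by (intro power_increasing) auto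
    finally show ?thesis .
  next
    case False
    hence tx: "t * x\<^sup>2 > 64" by simp
    hence x0: "x \<noteq> 0" by auto
    have "1 / (120 * t) = x\<^sup>2 / (60 * (t * x\<^sup>2 + t * x\<^sup>2))" using x0 t by (simp add: field_simps)
    also have "\<dots> \<le> x\<^sup>2 / (60 * (64 + t * x\<^sup>2))"
      using tx by (intro divide_left_mono mult_pos_pos) auto
    also have "\<dots> \<le> u" by (rule u_ge)
    finally have "(1 / (120 * t)) ^ 3 \<le> u ^ 3" using t by (intro power_mono) auto
    moreover have "\<rho> \<le> (1 / (120 * t)) ^ 3"
    proof -
      have "x\<^sup>2 \<le> (pi * sqrt V)\<^sup>2" using x by (metis abs_ge_zero power2_abs power_mono)
      also have "\<dots> = pi\<^sup>2 * V" using V by (simp add: power_mult_distrib)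
      also have "\<dots> \<le> 4\<^sup>2 * (64 / t ^ 3)"
        using V pi_less_4 pi_gt_zero by (intro mult_mono power_mono) auto
      finally have "x\<^sup>2 \<le> 1024 / t ^ 3" by simp
      thus ?thesis using t by (simp add: \<rho>_def A_def field_simps power_divide power_mult_distrib)
    qed
    moreover have "1 + u ^ 3 \<le> (1 + u) ^ 3"
      using u0 by (simp add: power3_eq_cube algebra_simps)
    ultimately show ?thesis by linarith
  qed
  \<comment> \<open>The sixth power yields (1 + x^2)^2: one factor becomes the majorant, the other
    absorbs 1 + |x|.\<close>
  have "1 + u \<le> 6 * (1 + u / 6)" using u0 by simp
  also have "\<dots> \<le> 6 * exp (u / 6)" by (intro mult_left_mono exp_ge_add_one_self) auto
  finally have "(1 + u) ^ 6 \<le> (6 * exp (u / 6)) ^ 6" using u0 by (intro power_mono) auto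
  also have "\<dots> = 6 ^ 6 * exp u" by (simp add: power_mult_distrib flip: exp_of_nat_mult)
  finally have e6: "(1 + u) ^ 6 \<le> 6 ^ 6 * exp u" .
  have "(1 + \<rho>)\<^sup>2 \<le> ((1 + u) ^ 3)\<^sup>2" using cube \<rho>0 by (intro power_mono) auto
  also have "\<dots> = (1 + u) ^ 6" by (simp flip: power_mult)
  finally have r2: "(1 + \<rho>)\<^sup>2 \<le> 6 ^ 6 * exp u" using e6 by linarith
  have "1 + x\<^sup>2 \<le> A * (1 + \<rho>)" by (simp add: \<rho>_def A_def)
  hence "(1 + x\<^sup>2)\<^sup>2 \<le> (A * (1 + \<rho>))\<^sup>2" by (intro power_mono) auto
  hence x4: "(1 + x\<^sup>2)\<^sup>2 \<le> A\<^sup>2 * (6 ^ 6 * exp u)"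
    using mult_left_mono[OF r2, of "A\<^sup>2"] by (simp add: power_mult_distrib)
  have "1 + \<bar>x\<bar> \<le> 2 * (1 + x\<^sup>2)"
  proof -
    have "0 \<le> (\<bar>x\<bar> - 1)\<^sup>2" by simp
    hence "2 * \<bar>x\<bar> \<le> \<bar>x\<bar>\<^sup>2 + 1" by (simp add: power2_eq_square algebra_simps)
    thus ?thesis unfolding power2_abs using zero_le_power2[of x] by argo
  qed
  hence "(1 + \<bar>x\<bar>) * (1 + x\<^sup>2) \<le> 2 * (1 + x\<^sup>2) * (1 + x\<^sup>2)" by (intro mult_right_mono) auto
  also have "\<dots> = 2 * (1 + x\<^sup>2)\<^sup>2" by (simp add: power2_eq_square)
  also have "\<dots> \<le> 2 * (A\<^sup>2 * (6 ^ 6 * exp u))" using x4 by (intro mult_left_mono) auto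
  finally have "(1 + \<bar>x\<bar>) * (1 + x\<^sup>2) * exp (1 - u) \<le> 2 * (A\<^sup>2 * (6 ^ 6 * exp u)) * exp (1 - u)"
    by (intro mult_right_mono) auto
  also have "\<dots> = 2 * A\<^sup>2 * 6 ^ 6 * (exp u * exp (1 - u))" by (simp only: mult_ac)
  also have "exp u * exp (1 - u) = exp 1" by (simp flip: exp_add)
  finally have "(1 + \<bar>x\<bar>) * exp (1 - u) * (1 + x\<^sup>2) \<le> 2 * A\<^sup>2 * 6 ^ 6 * exp 1" by (simp only: mult_ac)
  moreover have "1 + x\<^sup>2 > 0" by (intro add_pos_nonneg) auto
  ultimately show ?thesis unfolding u_def[symmetric] by (simp only: pos_le_divide_eq)
qed

text \<open>Divided by t, with \<theta> = x / sqrt V and t sqrt V >= 1, this is at most 1 + |x|: the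
  growth that the majorant has to absorb.\<close>

lemma norm_one_minus_exp_cis_le:
  fixes t \<theta> :: real
  assumes "t \<ge> 0"
  shows "norm (1 - of_real (exp (- t)) * cis \<theta>) \<le> t + \<bar>\<theta>\<bar>"
proof -
  have "1 - of_real (exp (- t)) * cis \<theta> = of_real (1 - exp (- t)) + of_real (exp (- t)) * (1 - cis \<theta>)"
    by (simp add: algebra_simps)
  also have "norm \<dots> \<le> norm (of_real (1 - exp (- t)) :: complex) + norm (of_real (exp (- t)) * (1 - cis \<theta>))"
    by (rule norm_triangle_ineq)
  also have "norm (of_real (1 - exp (- t)) :: complex) \<le> t"
    using assms exp_ge_add_one_self[of "- t"] by (simp only: norm_of_real) simp
  also have "norm (of_real (exp (- t)) * (1 - cis \<theta>)) \<le> 1 * \<bar>\<theta>\<bar>"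
    unfolding norm_mult
  proof (intro mult_mono)
    have "norm (1 - cis \<theta>) = 2 * \<bar>sin (\<theta> / 2)\<bar>"
      using dist_exp_i_1[of \<theta>] by (simp add: cis_conv_exp norm_minus_commute)
    also have "\<dots> \<le> 2 * \<bar>\<theta> / 2\<bar>" by (intro mult_left_mono abs_sin_x_le_abs_x) auto
    finally show "norm (1 - cis \<theta>) \<le> \<bar>\<theta>\<bar>" by simp
  qed (use assms in auto)
  finally show ?thesis by simp
qed

text \<open>For t > 0 the value at \<theta> = 0 is 1. The divisor is common to both coefficient
  integrals and drops out of their quotient.\<close>

definition normalized_prod :: "nat \<Rightarrow> real \<Rightarrow> real \<Rightarrow> complex" where
  "normalized_prod n t \<theta> = partition_prod n (of_real (exp (- t)) * cis \<theta>)
     / partition_prod n (of_real (exp (- t))) * cis (- (real n * \<theta>))"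

text \<open>By the saddle point equation the first-order term is i n \<theta>, which cancels against
  \<open>cis (- (real n * \<theta>))\<close>. Putting the error into the exponent keeps the formula
  exact for every \<theta>.\<close>

lemma normalized_prod_gaussian_error:
  assumes s: "saddle_equation n t" and t: "t \<le> 1"
  shows "\<exists>w. normalized_prod n t \<theta> = exp (w - of_real (\<theta>\<^sup>2 * partition_variance n t / 2))
     \<and> norm w \<le> 864 * \<bar>\<theta>\<bar> ^ 3 / t ^ 4"
proof -
  have t0: "t > 0" using s by (simp add: saddle_equation_def)
  define e where "e = (\<lambda>k. exp (- (real k * t)))"
  define D where "D = partition_log n (Complex t (- \<theta>)) - partition_log n (of_real t)"
  have "(\<Sum>k=2..n. real k * e k / (1 - e k)) = (\<Sum>k=2..n. real k / (exp (real k * t) - 1))"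
  proof (intro sum.cong refl)
    fix k assume "k \<in> {2..n}"
    hence "exp (real k * t) > 1" using t0 by simp
    thus "real k * e k / (1 - e k) = real k / (exp (real k * t) - 1)"
      by (simp add: e_def exp_minus field_simps)
  qed
  also have "\<dots> = real n" using s by (simp add: saddle_equation_def)
  finally have mean: "(\<Sum>k=2..n. real k * e k / (1 - e k)) = real n" .
  define w where "w = D - (\<i> * of_real (\<theta> * real n) - of_real (\<theta>\<^sup>2 * partition_variance n t / 2))"
  have "norm w \<le> (\<Sum>k=2..n. 2 * (real k ^ 3 * e k / (1 - e k) ^ 3)) * \<bar>\<theta>\<bar> ^ 3 / 2"
    using partition_log_Taylor[OF t0, of n \<theta>] unfolding mean[unfolded e_def] w_def D_def e_def .
  also have "\<dots> \<le> (2 * (4 * (2 * real 3) ^ 3 / t ^ (3 + 1))) * \<bar>\<theta>\<bar> ^ 3 / 2"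
    unfolding sum_distrib_left[symmetric]
    using moment_sum_le[OF t0 t, of 3 n] unfolding e_def
    by (intro divide_right_mono mult_right_mono mult_left_mono) auto
  finally have w: "norm w \<le> 864 * \<bar>\<theta>\<bar> ^ 3 / t ^ 4" by simp
  have "exp (- Complex t (- \<theta>)) = of_real (exp (- t)) * cis \<theta>"
    by (simp add: exp_eq_polar)
  hence "partition_prod n (of_real (exp (- t)) * cis \<theta>) = exp (partition_log n (Complex t (- \<theta>)))"
    using exp_partition_log[of "Complex t (- \<theta>)" n] t0 by simp
  moreover have "partition_prod n (of_real (exp (- t))) = exp (partition_log n (of_real t))"
    using exp_partition_log[of "of_real t" n] t0 by (simp flip: exp_of_real)
  moreover have "cis (- (real n * \<theta>)) = exp (- (\<i> * of_real (\<theta> * real n)))"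
    by (simp add: cis_conv_exp mult_ac)
  ultimately have "normalized_prod n t \<theta> = exp (D - \<i> * of_real (\<theta> * real n))"
    unfolding normalized_prod_def D_def by (simp only: exp_diff exp_minus divide_inverse)
  also have "D - \<i> * of_real (\<theta> * real n) = w - of_real (\<theta>\<^sup>2 * partition_variance n t / 2)"
    by (simp add: w_def)
  finally show ?thesis using w by blast
qed

section \<open>The limit of the rescaled integrals\<close>

context
  fixes t V :: "nat \<Rightarrow> real"
  assumes saddle: "\<And>n. n \<ge> 2 \<Longrightarrow> saddle_equation n (t n)"
  defines "V \<equiv> \<lambda>n. partition_variance n (t n)"
begin

lemma t_pos: "n \<ge> 2 \<Longrightarrow> t n > 0"
  using saddle by (simp add: saddle_equation_def)

lemma t_at_right: "filterlim t (at_right 0) sequentially"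
  unfolding filterlim_at using saddle_limit(1)[OF saddle]
  by (auto intro!: eventually_mono[OF eventually_ge_at_top[of 2]] dest: t_pos)

text \<open>The indices at which all later bounds apply together. \<open>t n \<le> 1/6\<close> gives
  sqrt (6 t) <= 1 and hence t sqrt V >= 1; the last clause is the tail condition of the ratio
  bound.\<close>

definition good :: "nat \<Rightarrow> bool" where
  "good n \<longleftrightarrow> n \<ge> 4 \<and> t n \<le> 1/6 \<and> 1 / (6 * t n ^ 3) \<le> V n \<and> V n \<le> 64 / t n ^ 3
     \<and> exp (- (real n * t n)) \<le> t n"

lemma eventually_good: "eventually good sequentially"
proof -
  \<comment> \<open>From n t^2 >= 1/4 follows n t >= 1/(4t), so the tail condition reduces to an
    inequality in t alone.\<close>
  have "eventually (\<lambda>t::real. exp (- (1 / (4 * t))) \<le> t) (at_right 0)" by real_asymp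
  hence "eventually (\<lambda>n. exp (- (1 / (4 * t n))) \<le> t n) sequentially"
    using t_at_right by (rule eventually_compose_filterlim)
  moreover have "eventually (\<lambda>n. t n < 1/6) sequentially"
    using order_tendstoD(2)[OF saddle_limit(1)[OF saddle], of "1/6"] by simp
  ultimately show ?thesis
    using eventually_ge_at_top[of 4]
  proof eventually_elim
    case (elim n)
    have t0: "t n > 0" and s: "saddle_equation n (t n)" using elim t_pos[of n] saddle[of n] by auto
    have low: "1/4 \<le> real n * (t n)\<^sup>2" "1 / t n \<le> real n"
      using saddle_lower[OF s] elim by auto
    have "1 / (4 * t n) \<le> real n * t n"
      using low(1) t0 by (simp add: field_simps power2_eq_square)
    hence "exp (- (real n * t n)) \<le> exp (- (1 / (4 * t n)))" by simp
    hence "exp (- (real n * t n)) \<le> t n" using elim by linarith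
    thus ?case
      unfolding good_def V_def
      using partition_variance_lower[of "t n" n] partition_variance_upper[of "t n" n] elim t0 low(2) by simp
  qed
qed

lemma good_props:
  assumes "good n"
  shows "t n > 0" "V n > 0" "1 \<le> t n * sqrt (V n)" "1 / sqrt (V n) \<le> t n * sqrt (6 * t n)"
proof -
  show t0: "t n > 0" using assms by (intro t_pos) (simp add: good_def)
  have V1: "1 / (6 * t n ^ 3) \<le> V n" using assms by (simp add: good_def)
  have "0 < 1 / (6 * t n ^ 3)" using t0 by simp
  thus V0: "V n > 0" using V1 by linarith
  have *: "1 \<le> V n * (6 * t n ^ 3)" using V1 t0 by (simp add: field_simps)
  have "sqrt (V n) * (t n * sqrt (6 * t n)) = sqrt (V n * (6 * t n ^ 3))"
  proof -
    have "V n * (6 * t n ^ 3) = V n * ((t n)\<^sup>2 * (6 * t n))" by (simp add: power2_eq_square power3_eq_cube)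
    hence "sqrt (V n * (6 * t n ^ 3)) = sqrt (V n) * (sqrt ((t n)\<^sup>2) * sqrt (6 * t n))"
      by (simp only: real_sqrt_mult)
    thus ?thesis using t0 by simp
  qed
  also have "\<dots> \<ge> 1" using * by simp
  finally have s: "1 \<le> sqrt (V n) * (t n * sqrt (6 * t n))" .
  thus "1 / sqrt (V n) \<le> t n * sqrt (6 * t n)" using V0 by (simp add: pos_divide_le_eq mult.commute)
  have "sqrt (6 * t n) \<le> 1" using assms by (simp add: good_def)
  hence "sqrt (V n) * t n * sqrt (6 * t n) \<le> sqrt (V n) * t n * 1"
    using V0 t0 by (intro mult_left_mono) auto
  thus "1 \<le> t n * sqrt (V n)" using s by (simp add: mult_ac)
qed

lemma theta_over_t_tendsto_0: "(\<lambda>n. (x / sqrt (V n)) / t n) \<longlonglongrightarrow> 0"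
proof (rule Lim_null_comparison)
  show "eventually (\<lambda>n. norm ((x / sqrt (V n)) / t n) \<le> \<bar>x\<bar> * sqrt (6 * t n)) sequentially"
    using eventually_good
  proof eventually_elim
    case (elim n)
    note g = good_props[OF elim]
    have "norm ((x / sqrt (V n)) / t n) = \<bar>x\<bar> * (1 / sqrt (V n)) / t n" using g by simp
    also have "\<dots> \<le> \<bar>x\<bar> * (t n * sqrt (6 * t n)) / t n"
      using g by (intro divide_right_mono mult_left_mono) auto
    finally show ?case using g by simp
  qed
  have "(\<lambda>n. \<bar>x\<bar> * sqrt (6 * t n)) \<longlonglongrightarrow> \<bar>x\<bar> * sqrt (6 * 0)"
    by (intro tendsto_intros saddle_limit(1)[OF saddle])
  thus "(\<lambda>n. \<bar>x\<bar> * sqrt (6 * t n)) \<longlonglongrightarrow> 0" by simp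
qed

lemma theta_tendsto_0: "(\<lambda>n. x / sqrt (V n)) \<longlonglongrightarrow> 0"
proof -
  have "(\<lambda>n. (x / sqrt (V n)) / t n * t n) \<longlonglongrightarrow> 0 * 0"
    by (intro tendsto_intros theta_over_t_tendsto_0 saddle_limit(1)[OF saddle])
  moreover have "eventually (\<lambda>n. (x / sqrt (V n)) / t n * t n = x / sqrt (V n)) sequentially"
    using eventually_good by eventually_elim (use good_props(1) in force)
  ultimately show ?thesis by (simp add: Lim_transform_eventually)
qed

lemma normalized_prod_tendsto:
  "(\<lambda>n. normalized_prod n (t n) (x / sqrt (V n))) \<longlonglongrightarrow> of_real (exp (- x\<^sup>2 / 2))"
proof -
  have "\<exists>w. good n \<longrightarrow> (normalized_prod n (t n) (x / sqrt (V n)) = exp (w - of_real (x\<^sup>2 / 2))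
     \<and> norm w \<le> 864 * \<bar>x / sqrt (V n)\<bar> ^ 3 / t n ^ 4)" for n
  proof (cases "good n")
    case True
    have "(x / sqrt (V n))\<^sup>2 * V n = x\<^sup>2" using good_props(2)[OF True] by (simp add: power_divide)
    thus ?thesis
      using normalized_prod_gaussian_error[of n "t n" "x / sqrt (V n)"] saddle[of n] True
      unfolding V_def by (auto simp: good_def)
  qed auto
  then obtain w where w: "\<And>n. good n \<Longrightarrow> normalized_prod n (t n) (x / sqrt (V n)) = exp (w n - of_real (x\<^sup>2 / 2))"
    "\<And>n. good n \<Longrightarrow> norm (w n) \<le> 864 * \<bar>x / sqrt (V n)\<bar> ^ 3 / t n ^ 4"
    by metis
  have "w \<longlonglongrightarrow> 0"
  proof (rule Lim_null_comparison)
    \<comment> \<open>Since |\<theta>| <= |x| t sqrt (6 t), the cubic error |\<theta>|^3 / t^4 has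
      order sqrt t.\<close>
    show "eventually (\<lambda>n. norm (w n) \<le> 864 * (\<bar>x\<bar> ^ 3 * (6 * sqrt (6 * t n)))) sequentially"
      using eventually_good
    proof eventually_elim
      case (elim n)
      note g = good_props[OF elim]
      have sq: "(sqrt (6 * t n)) ^ 3 = 6 * t n * sqrt (6 * t n)" using g by (simp add: power3_eq_cube)
      have "norm (w n) \<le> 864 * \<bar>x / sqrt (V n)\<bar> ^ 3 / t n ^ 4" using w elim by blast
      also have "\<dots> = 864 * (\<bar>x\<bar> ^ 3 * (1 / sqrt (V n)) ^ 3) / t n ^ 4" using g by (simp add: power_divide)
      also have "\<dots> \<le> 864 * (\<bar>x\<bar> ^ 3 * (t n * sqrt (6 * t n)) ^ 3) / t n ^ 4"
        using g by (intro divide_right_mono mult_left_mono power_mono) auto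
      also have "\<dots> = 864 * (\<bar>x\<bar> ^ 3 * (6 * sqrt (6 * t n)))"
        using g by (simp add: power_mult_distrib sq eval_nat_numeral)
      finally show ?case .
    qed
    have "(\<lambda>n. 864 * (\<bar>x\<bar> ^ 3 * (6 * sqrt (6 * t n)))) \<longlonglongrightarrow> 864 * (\<bar>x\<bar> ^ 3 * (6 * sqrt (6 * 0)))"
      by (intro tendsto_intros saddle_limit(1)[OF saddle])
    thus "(\<lambda>n. 864 * (\<bar>x\<bar> ^ 3 * (6 * sqrt (6 * t n)))) \<longlonglongrightarrow> 0" by simp
  qed
  hence "(\<lambda>n. exp (w n - of_real (x\<^sup>2 / 2))) \<longlonglongrightarrow> exp (0 - of_real (x\<^sup>2 / 2))"
    by (intro tendsto_intros)
  also have "exp (0 - of_real (x\<^sup>2 / 2)) = (of_real (exp (- x\<^sup>2 / 2)) :: complex)"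
    by (simp flip: exp_of_real)
  finally show ?thesis
    by (rule Lim_transform_eventually) (use eventually_good w in \<open>auto elim: eventually_mono\<close>)
qed

text \<open>With s = -t + i \<theta> the quotient is (e^s - 1) / s times -s / t = 1 - i \<theta> /
  t. The second factor tends to 1 because \<theta> is o(t).\<close>

lemma one_minus_exp_cis_tendsto:
  "(\<lambda>n. (1 - of_real (exp (- t n)) * cis (x / sqrt (V n))) / of_real (t n)) \<longlonglongrightarrow> (1::complex)"
proof -
  define s where "s = (\<lambda>n. of_real (- t n) + \<i> * of_real (x / sqrt (V n)))"
  have "s \<longlonglongrightarrow> of_real (- 0) + \<i> * of_real 0"
    unfolding s_def by (intro tendsto_intros saddle_limit(1)[OF saddle] theta_tendsto_0)
  hence s0: "s \<longlonglongrightarrow> 0" by simp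
  have "eventually (\<lambda>n. s n \<noteq> 0) sequentially"
    using eventually_good
    by eventually_elim (use good_props(1) in \<open>force simp: s_def complex_eq_iff\<close>)
  hence "filterlim s (at 0) sequentially" using s0 by (simp add: filterlim_at)
  hence "(\<lambda>n. (exp (s n) - 1) / s n) \<longlonglongrightarrow> 1" by (rule filterlim_compose[OF lim_exp_minus_1])
  moreover have "(\<lambda>n. of_real 1 - \<i> * of_real ((x / sqrt (V n)) / t n)) \<longlonglongrightarrow> of_real 1 - \<i> * of_real 0"
    by (intro tendsto_intros theta_over_t_tendsto_0)
  ultimately have "(\<lambda>n. ((exp (s n) - 1) / s n) * (of_real 1 - \<i> * of_real ((x / sqrt (V n)) / t n))) \<longlonglongrightarrow> 1 * (of_real 1 - \<i> * of_real 0)"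
    by (rule tendsto_mult)
  hence "(\<lambda>n. ((exp (s n) - 1) / s n) * (of_real 1 - \<i> * of_real ((x / sqrt (V n)) / t n))) \<longlonglongrightarrow> 1" by simp
  moreover have "eventually (\<lambda>n. ((exp (s n) - 1) / s n) * (of_real 1 - \<i> * of_real ((x / sqrt (V n)) / t n))
      = (1 - of_real (exp (- t n)) * cis (x / sqrt (V n))) / of_real (t n)) sequentially"
    using eventually_good \<open>eventually (\<lambda>n. s n \<noteq> 0) sequentially\<close>
  proof eventually_elim
    case (elim n)
    have t0: "of_real (t n) \<noteq> (0::complex)" using good_props(1)[OF elim(1)] by simp
    have "exp (s n) = of_real (exp (- t n)) * cis (x / sqrt (V n))"
      by (simp only: s_def exp_add cis_conv_exp exp_of_real)
    moreover have "of_real 1 - \<i> * of_real ((x / sqrt (V n)) / t n) = - s n / of_real (t n)"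
      using t0 by (simp add: s_def field_simps)
    moreover have "((E - 1) / s n) * (- s n / T) = (1 - E) / T" for E T :: complex
      using elim(2) by (simp add: diff_divide_distrib left_diff_distrib)
    ultimately show ?case by (simp only:)
  qed
  ultimately show ?thesis by (rule Lim_transform_eventually)
qed

text \<open>j = 0 belongs to \<open>nu\<close> and j = 1 to \<open>gamma_gs\<close>. Dividing by t
  gives both the same limit, so one convergence argument covers them.\<close>

definition integrand :: "nat \<Rightarrow> nat \<Rightarrow> real \<Rightarrow> complex" where
  "integrand j n \<theta> = normalized_prod n (t n) \<theta> * ((1 - of_real (exp (- t n)) * cis \<theta>) / of_real (t n)) ^ j"

lemma continuous_integrand:
  assumes "n \<ge> 2"
  shows "continuous_on A (integrand j n)"
proof -
  have q: "exp (- t n) < 1" using t_pos[OF assms] by simp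
  have "(of_real (exp (- t n)) * cis \<theta>) ^ k \<noteq> 1" if "k \<in> {2..n}" for k \<theta>
    using norm_power_less_1[of "of_real (exp (- t n)) * cis \<theta>" k] q that
    by (auto simp: norm_mult)
  hence "continuous_on A (\<lambda>\<theta>. partition_prod n (of_real (exp (- t n)) * cis \<theta>))"
    unfolding partition_prod_def by (intro continuous_intros) auto
  thus ?thesis
    unfolding integrand_def normalized_prod_def divide_inverse by (intro continuous_intros)
qed

lemma scaled_integrand_bound:
  assumes g: "good n" and x: "\<bar>x\<bar> \<le> pi * sqrt (V n)" and j: "j \<le> 1"
  shows "norm (integrand j n (x / sqrt (V n))) \<le> 2 * 1769472000\<^sup>2 * 6 ^ 6 * exp 1 / (1 + x\<^sup>2)"
proof -
  note gp = good_props[OF g]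
  define \<theta> where "\<theta> = x / sqrt (V n)"
  have \<theta>: "\<bar>\<theta>\<bar> \<le> pi" using x gp by (simp add: \<theta>_def pos_divide_le_eq)
  have "norm ((1 - of_real (exp (- t n)) * cis \<theta>) / of_real (t n)) \<le> (t n + \<bar>\<theta>\<bar>) / t n"
    using norm_one_minus_exp_cis_le[of "t n" \<theta>] gp
    by (simp only: norm_divide norm_of_real abs_of_pos) (intro divide_right_mono, auto)
  also have "\<dots> = 1 + \<bar>x\<bar> / (t n * sqrt (V n))"
    using gp by (simp add: \<theta>_def add_divide_distrib mult.commute)
  also have "\<bar>x\<bar> / (t n * sqrt (V n)) \<le> \<bar>x\<bar> / 1"
    using gp by (intro divide_left_mono) auto
  finally have f1: "norm ((1 - of_real (exp (- t n)) * cis \<theta>) / of_real (t n)) \<le> 1 + \<bar>x\<bar>" by simp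
  have f: "norm ((1 - of_real (exp (- t n)) * cis \<theta>) / of_real (t n)) ^ j \<le> 1 + \<bar>x\<bar>"
    using f1 j by (cases j) auto
  have p: "norm (normalized_prod n (t n) \<theta>) \<le> exp (1 - \<theta>\<^sup>2 / (60 * t n * ((t n)\<^sup>2 + \<theta>\<^sup>2)))"
    using partition_prod_ratio_bound[of "t n" \<theta> n] gp \<theta> g
    by (simp add: normalized_prod_def norm_mult norm_divide good_def)
  have "norm (integrand j n \<theta>) = norm (normalized_prod n (t n) \<theta>) * norm ((1 - of_real (exp (- t n)) * cis \<theta>) / of_real (t n)) ^ j"
    by (simp add: integrand_def norm_mult norm_power)
  also have "\<dots> \<le> exp (1 - \<theta>\<^sup>2 / (60 * t n * ((t n)\<^sup>2 + \<theta>\<^sup>2))) * (1 + \<bar>x\<bar>)"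
    using p f by (intro mult_mono) auto
  also have "\<dots> \<le> 2 * 1769472000\<^sup>2 * 6 ^ 6 * exp 1 / (1 + x\<^sup>2)"
    using dominator_bound[of "t n" "V n" x] gp x g by (simp add: \<theta>_def good_def mult.commute)
  finally show ?thesis by (simp add: \<theta>_def)
qed

lemma integral_integrand_tendsto:
  assumes j: "j \<le> 1"
  shows "(\<lambda>n. of_real (sqrt (V n)) * integral {-pi..pi} (integrand j n))
     \<longlonglongrightarrow> of_real (LINT x|lborel. exp (- x\<^sup>2 / 2))"
proof -
  obtain n0 where n0: "\<And>n. n \<ge> n0 \<Longrightarrow> good n" using eventually_good by (auto simp: eventually_sequentially)
  \<comment> \<open>Extension by 0, so that the rescaled integrals all run over the whole
    line.\<close>
  define h where "h = (\<lambda>n \<theta>. indicator {-pi..pi} \<theta> *\<^sub>R integrand j n \<theta>)"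
  define w :: "real \<Rightarrow> real" where "w = (\<lambda>x. 2 * 1769472000\<^sup>2 * 6 ^ 6 * exp 1 * inverse (1 + x\<^sup>2))"
  have h_int: "integrable lborel (h n)" and h_eq: "integral\<^sup>L lborel (h n) = integral {-pi..pi} (integrand j n)"
    if "good n" for n
  proof -
    have "set_integrable lborel {-pi..pi} (integrand j n)"
      using that by (intro borel_integrable_atLeastAtMost' continuous_integrand) (auto simp: good_def)
    thus "integrable lborel (h n)" "integral\<^sup>L lborel (h n) = integral {-pi..pi} (integrand j n)"
      using set_borel_integral_eq_integral(2)[of "{-pi..pi}" "integrand j n"]
      by (auto simp: h_def set_integrable_def set_lebesgue_integral_def)
  qed
  have lim: "(\<lambda>n. h n (x / sqrt (V n))) \<longlonglongrightarrow> of_real (exp (- x\<^sup>2 / 2))" for x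
  proof -
    have "(\<lambda>n. integrand j n (x / sqrt (V n))) \<longlonglongrightarrow> of_real (exp (- x\<^sup>2 / 2)) * 1 ^ j"
      unfolding integrand_def
      by (intro tendsto_intros normalized_prod_tendsto one_minus_exp_cis_tendsto)
    moreover have "eventually (\<lambda>n. \<bar>x / sqrt (V n)\<bar> < pi) sequentially"
      using order_tendstoD(2)[OF tendsto_rabs_zero[OF theta_tendsto_0[of x]], of pi] by simp
    hence "eventually (\<lambda>n. integrand j n (x / sqrt (V n)) = h n (x / sqrt (V n))) sequentially"
    proof eventually_elim
      case (elim n)
      hence "x / sqrt (V n) \<in> {-pi..pi}" unfolding abs_less_iff by simp
      thus ?case by (simp add: h_def)
    qed
    ultimately show ?thesis by (simp add: Lim_transform_eventually)
  qed
  \<comment> \<open>The bounds are available only for good n, whereas dominated convergence asks for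
    them at every index; hence the shift by \<open>n0\<close>, undone afterwards.\<close>
  have "(\<lambda>i. LINT x|lborel. h (i + n0) (x / sqrt (V (i + n0)))) \<longlonglongrightarrow> (LINT x|lborel. of_real (exp (- x\<^sup>2 / 2)))"
  proof (rule integral_dominated_convergence[where w = w])
    show "(\<lambda>x. of_real (exp (- x\<^sup>2 / 2)) :: complex) \<in> borel_measurable lborel" by measurable
    show "(\<lambda>x. h (i + n0) (x / sqrt (V (i + n0)))) \<in> borel_measurable lborel" for i
    proof -
      have [measurable]: "h (i + n0) \<in> borel_measurable borel"
        using h_int[OF n0, of "i + n0"] by (auto dest: borel_measurable_integrable)
      show ?thesis by measurable
    qed
    show "integrable lborel w"
      using integrable_inverse_1_plus_square unfolding w_def
      by (intro integrable_mult_right) (simp add: set_integrable_def)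
    show "AE x in lborel. (\<lambda>i. h (i + n0) (x / sqrt (V (i + n0)))) \<longlonglongrightarrow> of_real (exp (- x\<^sup>2 / 2))"
      using lim by (intro AE_I2 LIMSEQ_ignore_initial_segment[of "\<lambda>n. h n (_ / sqrt (V n))"])
    show "AE x in lborel. norm (h (i + n0) (x / sqrt (V (i + n0)))) \<le> w x" for i
    proof (rule AE_I2)
      fix x :: real
      have g: "good (i + n0)" by (rule n0) simp
      show "norm (h (i + n0) (x / sqrt (V (i + n0)))) \<le> w x"
      proof (cases "\<bar>x\<bar> \<le> pi * sqrt (V (i + n0))")
        case True
        have "norm (h (i + n0) (x / sqrt (V (i + n0)))) \<le> norm (integrand j (i + n0) (x / sqrt (V (i + n0))))"
          by (auto simp: h_def indicator_def)
        thus ?thesis using scaled_integrand_bound[OF g True j] by (simp add: w_def divide_inverse)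
      next
        case False
        hence "x / sqrt (V (i + n0)) \<notin> {-pi..pi}"
          using good_props(2)[OF g] by (auto simp: pos_divide_le_eq pos_le_divide_eq abs_le_iff)
        thus ?thesis by (simp add: h_def w_def)
      qed
    qed
  qed
  hence "(\<lambda>n. LINT x|lborel. h n (x / sqrt (V n))) \<longlonglongrightarrow> (LINT x|lborel. of_real (exp (- x\<^sup>2 / 2)))"
    by (rule LIMSEQ_offset)
  moreover have "eventually (\<lambda>n. (LINT x|lborel. h n (x / sqrt (V n))) = of_real (sqrt (V n)) * integral {-pi..pi} (integrand j n)) sequentially"
    using eventually_good
  proof eventually_elim
    case (elim n)
    have V0: "sqrt (V n) > 0" using good_props(2)[OF elim] by simp
    have "integral\<^sup>L lborel (h n) = \<bar>1 / sqrt (V n)\<bar> *\<^sub>R (LINT x|lborel. h n (0 + 1 / sqrt (V n) * x))"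
      using V0 by (intro lborel_integral_real_affine) simp
    thus ?case using V0 h_eq[OF elim] by (simp add: scaleR_conv_of_real)
  qed
  ultimately have "(\<lambda>n. of_real (sqrt (V n)) * integral {-pi..pi} (integrand j n)) \<longlonglongrightarrow> (LINT x|lborel. complex_of_real (exp (- x\<^sup>2 / 2)))"
    by (rule Lim_transform_eventually)
  thus ?thesis by simp
qed

lemma gamma_over_nu_tendsto: "(\<lambda>n. real (gamma_gs n) / (real (nu n) * t n)) \<longlonglongrightarrow> 1"
proof -
  define G where "G = (LINT x|lborel. exp (- x\<^sup>2 / 2 :: real))"
  \<comment> \<open>The common limit must be nonzero to divide by it; the normal density identifies
    it as sqrt (2 pi).\<close>
  have G: "G \<noteq> 0"
  proof -
    have "(LINT x|lborel. exp (- x\<^sup>2 / 2 :: real)) = sqrt (2 * pi) * (LINT x|lborel. std_normal_density x)"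
      by (subst integral_mult_right_zero[symmetric]) (auto simp: std_normal_density_def intro!: Bochner_Integration.integral_cong)
    also have "(LINT x|lborel. std_normal_density x) = 1" by simp
    finally show ?thesis by (simp add: G_def)
  qed
  have "(\<lambda>n. (of_real (sqrt (V n)) * integral {-pi..pi} (integrand 1 n)) / (of_real (sqrt (V n)) * integral {-pi..pi} (integrand 0 n)))
     \<longlonglongrightarrow> of_real G / of_real G"
    unfolding G_def using G[unfolded G_def] by (intro tendsto_divide integral_integrand_tendsto) auto
  hence "(\<lambda>n. (of_real (sqrt (V n)) * integral {-pi..pi} (integrand 1 n)) / (of_real (sqrt (V n)) * integral {-pi..pi} (integrand 0 n)))
     \<longlonglongrightarrow> of_real 1" using G by simp
  moreover have "eventually (\<lambda>n. (of_real (sqrt (V n)) * integral {-pi..pi} (integrand 1 n)) / (of_real (sqrt (V n)) * integral {-pi..pi} (integrand 0 n))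
     = complex_of_real (real (gamma_gs n) / (real (nu n) * t n))) sequentially"
    using eventually_good
  proof eventually_elim
    case (elim n)
    note gp = good_props[OF elim]
    have n: "n \<ge> 4" using elim by (simp add: good_def)
    define q where "q = exp (- t n)"
    define P where "P = partition_prod n (of_real q)"
    have q: "0 < q" "q < 1" using gp by (auto simp: q_def)
    have P0: "P \<noteq> 0"
      using exp_partition_log[of "of_real (t n)" n] gp exp_not_eq_zero[of "partition_log n (of_real (t n))"]
      by (simp add: P_def q_def flip: exp_of_real)
    have "(integrand 0 n has_integral of_real (2 * pi * real (nu n) * q ^ n) / P) {-pi..pi}"
      using has_integral_divide[OF nu_integral[of q n], of P] q n
      by (simp add: integrand_def[abs_def] normalized_prod_def q_def P_def)
    hence i0: "integral {-pi..pi} (integrand 0 n) = of_real (2 * pi * real (nu n) * q ^ n) / P"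
      by (rule integral_unique)
    have "(integrand 1 n has_integral of_real (2 * pi * real (gamma_gs n) * q ^ n) / (P * of_real (t n))) {-pi..pi}"
      using has_integral_divide[OF gamma_integral[of q n], of "P * of_real (t n)"] q n
      by (simp add: integrand_def[abs_def] normalized_prod_def q_def P_def mult_ac)
    hence i1: "integral {-pi..pi} (integrand 1 n) = of_real (2 * pi * real (gamma_gs n) * q ^ n) / (P * of_real (t n))"
      by (rule integral_unique)
    \<comment> \<open>sqrt V, 2 pi q^n and 1/P cancel; of the normalisation only the single t
      remains.\<close>
    show ?case unfolding i0 i1 using gp P0 q by (simp add: field_simps)
  qed
  ultimately have "(\<lambda>n. complex_of_real (real (gamma_gs n) / (real (nu n) * t n))) \<longlonglongrightarrow> of_real 1"
    by (rule Lim_transform_eventually)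
  thus ?thesis by (simp only: tendsto_of_real_iff)
qed

end

theorem theorem2:
  shows "(\<lambda>n. real (nu n)) \<sim>[at_top]
         (\<lambda>n. real (gamma_gs n) * sqrt (real n / (pi\<^sup>2 / 6)))"
proof -
  obtain t where t: "\<And>n. n \<ge> 2 \<Longrightarrow> saddle_equation n (t n)" using saddle_exists by metis
  have "(\<lambda>n. sqrt (real n * (t n)\<^sup>2 / (pi\<^sup>2 / 6))) \<longlonglongrightarrow> sqrt (pi\<^sup>2 / 6 / (pi\<^sup>2 / 6))"
    by (intro tendsto_intros saddle_limit(2)[OF t]) auto
  hence "(\<lambda>n. inverse (real (gamma_gs n) / (real (nu n) * t n) * sqrt (real n * (t n)\<^sup>2 / (pi\<^sup>2 / 6)))) \<longlonglongrightarrow> inverse (1 * 1)"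
    using gamma_over_nu_tendsto[OF t] by (intro tendsto_intros) auto
  moreover have "eventually (\<lambda>n. inverse (real (gamma_gs n) / (real (nu n) * t n) * sqrt (real n * (t n)\<^sup>2 / (pi\<^sup>2 / 6)))
     = real (nu n) / (real (gamma_gs n) * sqrt (real n / (pi\<^sup>2 / 6)))) sequentially"
    using eventually_ge_at_top[of 2]
  proof eventually_elim
    case (elim n)
    have t0: "t n > 0" using t[OF elim] by (simp add: saddle_equation_def)
    \<comment> \<open>Once pulled out of the root, t cancels against the t in the quotient limit,
      which eliminates the saddle point from the result.\<close>
    have "real n * (t n)\<^sup>2 / (pi\<^sup>2 / 6) = (t n)\<^sup>2 * (real n / (pi\<^sup>2 / 6))" by simp
    hence "sqrt (real n * (t n)\<^sup>2 / (pi\<^sup>2 / 6)) = t n * sqrt (real n / (pi\<^sup>2 / 6))"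
      using t0 by (simp only: real_sqrt_mult real_sqrt_abs abs_of_pos)
    thus ?case using t0 by (simp only:) (simp add: field_simps)
  qed
  ultimately have "(\<lambda>n. real (nu n) / (real (gamma_gs n) * sqrt (real n / (pi\<^sup>2 / 6)))) \<longlonglongrightarrow> 1"
    by (simp add: Lim_transform_eventually)
  thus ?thesis by (rule asymp_equivI')
qed

end
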